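(* Let $b\ge 1$ be an integer and let $c\approx 1.764$ be the positive real root of $c=\exp(1/c)$. Let $q$ be an integer with $q\ge 1+\lceil cb\rceil$. Then the infinite-volume Gibbs measure $p$ on $q$-colorings of the infinite $(b+1)$-regular tree $\widehat{T}^b$ has strong spatial mixing with rate $\delta(d)=C\exp(-ad)$ for some positive constants $C$ and $a$.
   Context: $\widehat{T}^b$ (Cayley tree, Bethe lattice) is the infinite tree in which every vertex has degree $b+1$. Write $[q]=\{1,\ldots,q\}$. A $q$-coloring of a graph $G=(V,E)$ is a function $\sigma:V\to[q]$ with $\sigma(u)\ne\sigma(v)$ for every $\{u,v\}\in E$. A probability measure $p$ on the set of $q$-colorings of an infinite graph $G$ is an infinite-volume Gibbs measure if for every finite region $R\subseteq V$ and any $q$-coloring $\sigma$ of $G$, the conditional probability distribution $p(\cdot\mid\sigma(V\setminus R))$ is the uniform distribution on $q$-colorings of $R$ (compatible with the coloring $\sigma$ of $V\setminus R$). At least one such measure always exists; the claim is about any such $p$, with constants depending only on $b$ and $q$. For $U\subseteq V$, $\sigma_U$ denotes the restriction to $U$ of a $q$-coloring $\sigma$ of $G$. For $v\notin U$, $p_v^{\sigma_U}\in\mathbb{R}^q$ is the marginal distribution of the color of $v$ under $p$ conditioned on the coloring of $U$ being $\sigma_U$. (If this event has $p$-probability zero, the conditioned measure is understood as a probability measure on $q$-colorings agreeing with $\sigma_U$ on $U$ whose conditional distribution on each finite $R\subseteq V\setminus U$, given the colors outside $R$, is uniform on the compatible $q$-colorings of $R$.) $\mathrm{dist}(u,v)$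 is graph distance and $\mathrm{dist}(v,W)=\min_{u\in W}\mathrm{dist}(v,u)$. Definition (strong spatial mixing). Let $\delta:\mathbb{N}\to\mathbb{R}^+$. The infinite-volume Gibbs measure $p$ on $q$-colorings of $G=(V,E)$ has strong spatial mixing with rate $\delta(\cdot)$ if and only if for every $U\subseteq V$, every vertex $v\in V\setminus U$, and every pair of $q$-colorings $\sigma_U,\phi_U$ of $U$ (restrictions of $q$-colorings of $G$), $|p_v^{\sigma_U}-p_v^{\phi_U}|\le\delta(\mathrm{dist}(v,\Delta))$, where $\Delta\subseteq U$ is the (nonempty) set of vertices on which $\sigma_U$ and $\phi_U$ differ, and $|\cdot|$ is a fixed norm on $\mathbb{R}^q$ (the choice only affects the constant $C$). *)

theory Defs
  imports "HOL-Probability.Probability"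
begin

section \<open>Simple graphs and the regular tree\<close>

text \<open>A simple graph is a vertex set \<open>V\<close> with a symmetric irreflexive adjacency relation \<open>E\<close>:
  each undirected edge occurs in both orientations.\<close>

definition simple_graph :: "'v set \<Rightarrow> ('v \<times> 'v) set \<Rightarrow> bool" where
  "simple_graph V E \<longleftrightarrow> E \<subseteq> V \<times> V \<and> sym E \<and> irrefl E"

definition graph_connected :: "'v set \<Rightarrow> ('v \<times> 'v) set \<Rightarrow> bool" where
  "graph_connected V E \<longleftrightarrow> V \<noteq> {} \<and> (\<forall>u\<in>V. \<forall>v\<in>V. (u, v) \<in> E\<^sup>*)"

text \<open>The length bound excludes the back-and-forth walk along a single edge.\<close>

definition graph_cycle :: "('v \<times> 'v) set \<Rightarrow> 'v list \<Rightarrow> bool" where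
  "graph_cycle E xs \<longleftrightarrow> 3 \<le> length xs \<and> distinct xs \<and>
     (\<forall>i<length xs. (xs ! i, xs ! (Suc i mod length xs)) \<in> E)"

definition is_tree :: "'v set \<Rightarrow> ('v \<times> 'v) set \<Rightarrow> bool" where
  "is_tree V E \<longleftrightarrow> simple_graph V E \<and> graph_connected V E \<and> (\<nexists>xs. graph_cycle E xs)"

text \<open>Up to isomorphism there is exactly one such tree. For \<open>b \<ge> 1\<close> it is infinite.\<close>

definition cayley_tree :: "nat \<Rightarrow> 'v set \<Rightarrow> ('v \<times> 'v) set \<Rightarrow> bool" where
  "cayley_tree b V E \<longleftrightarrow> is_tree V E \<and>
     (\<forall>v\<in>V. finite {w. (v, w) \<in> E} \<and> card {w. (v, w) \<in> E} = b + 1)"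

definition graph_dist :: "('v \<times> 'v) set \<Rightarrow> 'v \<Rightarrow> 'v \<Rightarrow> nat" where
  "graph_dist E u v = (LEAST n. (u, v) \<in> E ^^ n)"

definition graph_set_dist :: "('v \<times> 'v) set \<Rightarrow> 'v \<Rightarrow> 'v set \<Rightarrow> nat" where
  "graph_set_dist E v W = (INF u\<in>W. graph_dist E v u)"


section \<open>Colorings and Gibbs measures\<close>

definition colorings :: "'v set \<Rightarrow> ('v \<times> 'v) set \<Rightarrow> nat \<Rightarrow> ('v \<Rightarrow> nat) set" where
  "colorings V E q = {\<sigma> \<in> V \<rightarrow>\<^sub>E {1..q}. \<forall>(u, v)\<in>E. \<sigma> u \<noteq> \<sigma> v}"

text \<open>A probability measure on the set of colorings, with the product \<open>\<sigma>\<close>-algebra.\<close>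

definition coloring_measure ::
    "'v set \<Rightarrow> ('v \<times> 'v) set \<Rightarrow> nat \<Rightarrow> ('v \<Rightarrow> nat) measure \<Rightarrow> bool" where
  "coloring_measure V E q p \<longleftrightarrow> prob_space p \<and> space p = colorings V E q \<and>
     sets p = sets (restrict_space (Pi\<^sub>M V (\<lambda>_. count_space {1..q})) (colorings V E q))"

text \<open>Colorings of \<open>R\<close> that extend the coloring \<open>\<sigma>\<close> of \<open>V - R\<close>.\<close>

definition compatible_colorings ::
    "'v set \<Rightarrow> ('v \<times> 'v) set \<Rightarrow> nat \<Rightarrow> 'v set \<Rightarrow> ('v \<Rightarrow> nat) \<Rightarrow> ('v \<Rightarrow> nat) set" where
  "compatible_colorings V E q R \<sigma> =
     {\<tau> \<in> R \<rightarrow>\<^sub>E {1..q}. override_on \<sigma> \<tau> R \<in> colorings V E q}"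

text \<open>The sub-\<open>\<sigma>\<close>-algebra generated by the colors of the vertices in \<open>W\<close>.\<close>

definition color_algebra ::
    "'v set \<Rightarrow> ('v \<times> 'v) set \<Rightarrow> nat \<Rightarrow> 'v set \<Rightarrow> ('v \<Rightarrow> nat) measure" where
  "color_algebra V E q W =
     vimage_algebra (colorings V E q) (\<lambda>\<sigma>. restrict \<sigma> W) (Pi\<^sub>M W (\<lambda>_. count_space {1..q}))"

text \<open>A version of the conditional distribution of the coloring of \<open>R\<close> given the colors
  outside \<open>R\<close> is uniform on the compatible colorings. Since the condition is usually an event of
  probability zero, this is expressed by conditional expectations, hence almost everywhere
  in \<open>\<sigma>\<close>.\<close>

definition uniform_given_outside ::
    "'v set \<Rightarrow> ('v \<times> 'v) set \<Rightarrow> nat \<Rightarrow> ('v \<Rightarrow> nat) measure \<Rightarrow> 'v set \<Rightarrow> bool" where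
  "uniform_given_outside V E q p R \<longleftrightarrow>
     (\<forall>\<tau>\<in>R \<rightarrow>\<^sub>E {1..q}. AE \<sigma> in p.
        real_cond_exp p (color_algebra V E q (V - R))
            (indicator {\<omega>\<in>space p. restrict \<omega> R = \<tau>}) \<sigma>
          = pmf (pmf_of_set (compatible_colorings V E q R \<sigma>)) \<tau>)"

text \<open>The conditional expectation above is not degenerate.\<close>

lemma subalgebra_color_algebra:
  assumes "coloring_measure V E q p" and "W \<subseteq> V"
  shows "subalgebra p (color_algebra V E q W)"
proof -
  have sp: "space p = colorings V E q"
    and st: "sets p = sets (restrict_space (Pi\<^sub>M V (\<lambda>_. count_space {1..q})) (colorings V E q))"
    using assms(1) by (auto simp: coloring_measure_def)
  have "(\<lambda>\<sigma>. restrict \<sigma> W) \<in> measurable (Pi\<^sub>M V (\<lambda>_. count_space {1..q}))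
      (Pi\<^sub>M W (\<lambda>_. count_space {1..q}))"
    using assms(2) by (rule measurable_restrict_subset)
  then have "(\<lambda>\<sigma>. restrict \<sigma> W) \<in> measurable
      (restrict_space (Pi\<^sub>M V (\<lambda>_. count_space {1..q})) (colorings V E q))
      (Pi\<^sub>M W (\<lambda>_. count_space {1..q}))"
    by (rule measurable_restrict_space1)
  then have "(\<lambda>\<sigma>. restrict \<sigma> W) \<in> measurable p (Pi\<^sub>M W (\<lambda>_. count_space {1..q}))"
    using st measurable_cong_sets by blast
  then show ?thesis
    unfolding subalgebra_def color_algebra_def sp[symmetric]
    by (simp add: measurable_iff_sets)
qed

definition gibbs_measure ::
    "'v set \<Rightarrow> ('v \<times> 'v) set \<Rightarrow> nat \<Rightarrow> ('v \<Rightarrow> nat) measure \<Rightarrow> bool" where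
  "gibbs_measure V E q p \<longleftrightarrow> coloring_measure V E q p \<and>
     (\<forall>R. R \<subseteq> V \<and> finite R \<longrightarrow> uniform_given_outside V E q p R)"


section \<open>Strong spatial mixing\<close>

definition agreeing :: "('v \<Rightarrow> nat) measure \<Rightarrow> 'v set \<Rightarrow> ('v \<Rightarrow> nat) \<Rightarrow> ('v \<Rightarrow> nat) set" where
  "agreeing p U \<sigma> = {\<omega>\<in>space p. \<forall>u\<in>U. \<omega> u = \<sigma> u}"

text \<open>\<open>\<nu>\<close> is \<open>p\<close> conditioned on the coloring of \<open>U\<close> being \<open>\<sigma>\<close>. If that event has probability zero,
  there may be several such \<open>\<nu>\<close>.\<close>

definition conditioned_measure ::
    "'v set \<Rightarrow> ('v \<times> 'v) set \<Rightarrow> nat \<Rightarrow> ('v \<Rightarrow> nat) measure \<Rightarrow> 'v set \<Rightarrow> ('v \<Rightarrow> nat) \<Rightarrow>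
       ('v \<Rightarrow> nat) measure \<Rightarrow> bool" where
  "conditioned_measure V E q p U \<sigma> \<nu> \<longleftrightarrow>
     (if measure p (agreeing p U \<sigma>) > 0 then \<nu> = uniform_measure p (agreeing p U \<sigma>)
      else coloring_measure V E q \<nu> \<and> (AE \<omega> in \<nu>. \<forall>u\<in>U. \<omega> u = \<sigma> u) \<and>
           (\<forall>R. R \<subseteq> V - U \<and> finite R \<longrightarrow> uniform_given_outside V E q \<nu> R))"

text \<open>Vectors in \<open>\<real>\<^sup>q\<close> are functions that vanish outside \<open>{1..q}\<close>.\<close>

definition color_marginal :: "('v \<Rightarrow> nat) measure \<Rightarrow> 'v \<Rightarrow> nat \<Rightarrow> real" where
  "color_marginal \<nu> v = (\<lambda>i. measure \<nu> {\<omega>\<in>space \<nu>. \<omega> v = i})"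

definition real_vectors :: "nat \<Rightarrow> (nat \<Rightarrow> real) set" where
  "real_vectors q = {x. \<forall>i. i \<notin> {1..q} \<longrightarrow> x i = 0}"

definition vector_norm :: "nat \<Rightarrow> ((nat \<Rightarrow> real) \<Rightarrow> real) \<Rightarrow> bool" where
  "vector_norm q N \<longleftrightarrow>
     (\<forall>x\<in>real_vectors q. 0 \<le> N x \<and> (N x = 0 \<longleftrightarrow> x = (\<lambda>_. 0))) \<and>
     (\<forall>r. \<forall>x\<in>real_vectors q. N (\<lambda>i. r * x i) = \<bar>r\<bar> * N x) \<and>
     (\<forall>x\<in>real_vectors q. \<forall>y\<in>real_vectors q. N (\<lambda>i. x i + y i) \<le> N x + N y)"

definition strong_spatial_mixing ::
    "((nat \<Rightarrow> real) \<Rightarrow> real) \<Rightarrow> 'v set \<Rightarrow> ('v \<times> 'v) set \<Rightarrow> nat \<Rightarrow> ('v \<Rightarrow> nat) measure \<Rightarrow>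
       (nat \<Rightarrow> real) \<Rightarrow> bool" where
  "strong_spatial_mixing N V E q p \<delta> \<longleftrightarrow>
     (\<forall>U v \<sigma> \<phi> \<nu> \<nu>'. U \<subseteq> V \<and> v \<in> V - U \<and>
        \<sigma> \<in> colorings V E q \<and> \<phi> \<in> colorings V E q \<and> {u\<in>U. \<sigma> u \<noteq> \<phi> u} \<noteq> {} \<and>
        conditioned_measure V E q p U \<sigma> \<nu> \<and> conditioned_measure V E q p U \<phi> \<nu>' \<longrightarrow>
        N (\<lambda>i. color_marginal \<nu> v i - color_marginal \<nu>' v i)
          \<le> \<delta> (graph_set_dist E v {u\<in>U. \<sigma> u \<noteq> \<phi> u}))"

end

theory Submission
  imports Defs
begin

text \<open>
  Fix the boundary colors outside a finite region around the root. The conditional marginals then obey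
  the tree recursion \<open>p\<^sub>w(i) \<propto> \<Prod>\<^sub>x (1 - p\<^sub>x(i))\<close>, the product being over the children \<open>x\<close> of \<open>w\<close>. Interpolate
  linearly in \<open>t\<close> between the messages that two boundary colorings send one level above the
  boundary, and let \<open>g\<^sub>w = (log p\<^sub>w)'\<close> be the logarithmic derivative of the message at \<open>w\<close>. The energy
  \<open>\<Sum>\<^sub>i p\<^sub>w(i) g\<^sub>w(i)\<^sup>2\<close> is a variance, hence at most \<open>\<Sum>\<^sub>i p\<^sub>w(i) (\<Sum>\<^sub>x p\<^sub>x(i) g\<^sub>x(i) / (1 - p\<^sub>x(i)))\<^sup>2\<close>. By
  Cauchy-Schwarz, the bound \<open>p\<^sub>w(i) \<le> \<Prod>\<^sub>x (1 - p\<^sub>x(i)) / (q - b)\<close>, and the fact that independent events of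
  probability at most \<open>1/2\<close> have probability at most \<open>1/2\<close> that exactly one of them occurs, the energy
  shrinks by the factor \<open>b / (2 (q - b - 1))\<close> per level. This factor is less than \<open>1\<close> because \<open>c > 3/2\<close>.
  The infinite-volume marginals are averages of such finite ones.
\<close>

section \<open>Energy estimates for the tree recursion\<close>

text \<open>If independent events have probabilities \<open>x j\<close>, the sum is the probability
  that exactly one of them occurs. A further event of probability \<open>y\<close> turns this
  probability \<open>B\<close> into at most \<open>y * (1 - B) + (1 - y) * B\<close>, which stays
  below 1/2 as long as \<open>y\<close> and \<open>B\<close> do.\<close>

lemma one_success_le_half:
  fixes x :: "'a \<Rightarrow> real"
  assumes "finite J" and "\<And>j. j \<in> J \<Longrightarrow> 0 \<le> x j \<and> x j \<le> 1/2"
  shows "(\<Sum>j\<in>J. x j * (\<Prod>l\<in>J-{j}. 1 - x l)) \<le> 1/2"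
proof -
  let ?A = "\<lambda>J. \<Prod>l\<in>J. 1 - x l"
  let ?B = "\<lambda>J. \<Sum>j\<in>J. x j * (\<Prod>l\<in>J-{j}. 1 - x l)"
  \<comment> \<open>The induction also carries \<open>?A J + ?B J \<le> 1\<close>: no success and
    exactly one success are disjoint events.\<close>
  have "?A J + ?B J \<le> 1 \<and> ?B J \<le> 1/2 \<and> 0 \<le> ?B J"
    using assms
  proof (induction J rule: finite_induct)
    case empty
    then show ?case by simp
  next
    case (insert a J)
    have IH: "?A J + ?B J \<le> 1" "?B J \<le> 1/2" "0 \<le> ?B J"
      using insert by auto
    have xa: "0 \<le> x a" "x a \<le> 1/2"
      using insert.prems by auto
    have A: "?A (insert a J) = (1 - x a) * ?A J"
      using insert by simp
    have "(\<Prod>l\<in>insert a J - {j}. 1 - x l) = (1 - x a) * (\<Prod>l\<in>J-{j}. 1 - x l)" if "j \<in> J" for j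
    proof -
      have "insert a J - {j} = insert a (J - {j})"
        using that insert.hyps by auto
      then show ?thesis
        using insert.hyps by simp
    qed
    then have "(\<Sum>j\<in>J. x j * (\<Prod>l\<in>insert a J-{j}. 1 - x l)) = (1 - x a) * ?B J"
      unfolding sum_distrib_left by (intro sum.cong) auto
    then have B: "?B (insert a J) = x a * ?A J + (1 - x a) * ?B J"
      using insert.hyps by simp
    have "x a * ?A J \<le> x a * (1 - ?B J)"
      using IH xa by (intro mult_left_mono) auto
    \<comment> \<open>Twice this product is the gap between 1/2 and the upper bound for the new
      sum.\<close>
    moreover have "0 \<le> (1/2 - ?B J) * (1/2 - x a)"
      using IH xa by simp
    ultimately have "?B (insert a J) \<le> 1/2"
      unfolding B by (simp add: algebra_simps)
    moreover have "0 \<le> ?A J"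
      using insert.prems by (intro prod_nonneg) (force simp: algebra_simps)
    then have "0 \<le> ?B (insert a J)"
      unfolding B using IH xa by simp
    moreover have "0 \<le> x a * ?B J"
      using IH xa by simp
    then have "?A (insert a J) + ?B (insert a J) \<le> 1"
      unfolding A B using IH by (simp add: algebra_simps)
    ultimately show ?case by blast
  qed
  then show ?thesis by blast
qed

text \<open>Cauchy-Schwarz after splitting each weight \<open>x j\<close> into two square roots, so
  that the second factor is the contribution of one color to the energies of the children.\<close>

lemma weighted_square_sum_le:
  fixes x g :: "'a \<Rightarrow> real"
  assumes "finite J" and x: "\<And>j. j \<in> J \<Longrightarrow> 0 \<le> x j"
  shows "(\<Sum>j\<in>J. x j * g j / (1 - x j))\<^sup>2
    \<le> (\<Sum>j\<in>J. x j / (1 - x j)\<^sup>2) * (\<Sum>j\<in>J. x j * (g j)\<^sup>2)"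
proof -
  have "(\<Sum>j\<in>J. x j * g j / (1 - x j)) = (\<Sum>j\<in>J. (sqrt (x j) / (1 - x j)) * (sqrt (x j) * g j))"
    using x by (intro sum.cong) auto
  also have "\<dots>\<^sup>2 \<le> (\<Sum>j\<in>J. (sqrt (x j) / (1 - x j))\<^sup>2) * (\<Sum>j\<in>J. (sqrt (x j) * g j)\<^sup>2)"
    by (rule Cauchy_Schwarz_ineq_sum)
  also have "\<dots> = (\<Sum>j\<in>J. x j / (1 - x j)\<^sup>2) * (\<Sum>j\<in>J. x j * (g j)\<^sup>2)"
    using x by (simp add: power_divide power_mult_distrib)
  finally show ?thesis .
qed

text \<open>For each color, the product in the bound on \<open>p i\<close> cancels one factor
  \<open>1 - x j i\<close> of the Cauchy-Schwarz weight, the other is at least \<open>1 - m\<close>,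
  and what remains is a probability of exactly one success. The resulting constant
  \<open>1 / (2 * s * (1 - m))\<close> does not depend on the color, so the sums over colors and
  children can be exchanged.\<close>

lemma energy_contraction:
  fixes x g :: "'a \<Rightarrow> 'c \<Rightarrow> real"
  assumes fin: "finite I" "finite J"
    and x: "\<And>j i. j \<in> J \<Longrightarrow> i \<in> I \<Longrightarrow> 0 \<le> x j i \<and> x j i \<le> m" and m: "m \<le> 1/2"
    and p: "\<And>i. i \<in> I \<Longrightarrow> 0 \<le> p i \<and> p i \<le> (\<Prod>j\<in>J. 1 - x j i) / s" and s: "s > 0"
    and g: "\<And>j. j \<in> J \<Longrightarrow> (\<Sum>i\<in>I. x j i * (g j i)\<^sup>2) \<le> B"
  shows "(\<Sum>i\<in>I. p i * (\<Sum>j\<in>J. x j i * g j i / (1 - x j i))\<^sup>2) \<le> card J / (2 * s * (1 - m)) * B"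
proof -
  have pM: "p i * (\<Sum>j\<in>J. x j i / (1 - x j i)\<^sup>2) \<le> 1 / (2 * s * (1 - m))" if i: "i \<in> I" for i
  proof -
    have x1: "0 \<le> x j i" "x j i \<le> m" "x j i \<le> 1/2" "x j i < 1" if "j \<in> J" for j
      using x[OF that i] m by auto
    have "p i * (\<Sum>j\<in>J. x j i / (1 - x j i)\<^sup>2)
        \<le> (\<Prod>j\<in>J. 1 - x j i) / s * (\<Sum>j\<in>J. x j i / (1 - x j i)\<^sup>2)"
      using p[OF i] x1 by (intro mult_right_mono sum_nonneg) auto
    also have "\<dots> = (\<Sum>j\<in>J. x j i / (1 - x j i) * (\<Prod>l\<in>J-{j}. 1 - x l i)) / s"
    proof -
      have "(\<Prod>l\<in>J. 1 - x l i) * (x j i / (1 - x j i)\<^sup>2)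
          = x j i / (1 - x j i) * (\<Prod>l\<in>J-{j}. 1 - x l i)" if "j \<in> J" for j
        using x1(4)[OF that] prod.remove[OF fin(2) that, of "\<lambda>l. 1 - x l i"]
        by (simp add: power2_eq_square)
      then have "(\<Prod>l\<in>J. 1 - x l i) * (\<Sum>j\<in>J. x j i / (1 - x j i)\<^sup>2)
          = (\<Sum>j\<in>J. x j i / (1 - x j i) * (\<Prod>l\<in>J-{j}. 1 - x l i))"
        unfolding sum_distrib_left by (rule sum.cong[OF refl])
      then show ?thesis
        unfolding times_divide_eq_left by (rule arg_cong)
    qed
    \<comment> \<open>Only one denominator is left here, so only one factor \<open>1 - m\<close> is
      lost.\<close>
    also have "\<dots> \<le> (\<Sum>j\<in>J. x j i / (1 - m) * (\<Prod>l\<in>J-{j}. 1 - x l i)) / s"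
      using x1 m s by (intro divide_right_mono sum_mono mult_right_mono prod_nonneg)
        (auto intro!: divide_left_mono mult_pos_pos simp: less_imp_le)
    also have "\<dots> = (\<Sum>j\<in>J. x j i * (\<Prod>l\<in>J-{j}. 1 - x l i)) / (s * (1 - m))"
      by (simp add: sum_divide_distrib mult.commute)
    also have "\<dots> \<le> (1/2) / (s * (1 - m))"
      using m s x1 fin by (intro divide_right_mono one_success_le_half) auto
    finally show ?thesis by simp
  qed
  have "(\<Sum>i\<in>I. p i * (\<Sum>j\<in>J. x j i * g j i / (1 - x j i))\<^sup>2)
      \<le> (\<Sum>i\<in>I. 1 / (2 * s * (1 - m)) * (\<Sum>j\<in>J. x j i * (g j i)\<^sup>2))"
  proof (rule sum_mono)
    fix i assume i: "i \<in> I"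
    have "p i * (\<Sum>j\<in>J. x j i * g j i / (1 - x j i))\<^sup>2
        \<le> p i * ((\<Sum>j\<in>J. x j i / (1 - x j i)\<^sup>2) * (\<Sum>j\<in>J. x j i * (g j i)\<^sup>2))"
      using p[OF i] x i fin by (intro mult_left_mono weighted_square_sum_le) auto
    also have "\<dots> = (p i * (\<Sum>j\<in>J. x j i / (1 - x j i)\<^sup>2)) * (\<Sum>j\<in>J. x j i * (g j i)\<^sup>2)"
      by simp
    also have "\<dots> \<le> 1 / (2 * s * (1 - m)) * (\<Sum>j\<in>J. x j i * (g j i)\<^sup>2)"
      using x i by (intro mult_right_mono pM sum_nonneg) auto
    finally show "p i * (\<Sum>j\<in>J. x j i * g j i / (1 - x j i))\<^sup>2 \<le> \<dots>" .
  qed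
  also have "\<dots> = 1 / (2 * s * (1 - m)) * (\<Sum>j\<in>J. \<Sum>i\<in>I. x j i * (g j i)\<^sup>2)"
    unfolding sum_distrib_left[symmetric] by (subst sum.swap) simp
  also have "\<dots> \<le> 1 / (2 * s * (1 - m)) * (card J * B)"
    using s m sum_bounded_above[of J "\<lambda>j. \<Sum>i\<in>I. x j i * (g j i)\<^sup>2" B] g
    by (intro mult_left_mono) auto
  finally show ?thesis by simp
qed

lemma has_derivative_prod_one_minus:
  fixes y :: "'a \<Rightarrow> real \<Rightarrow> real"
  assumes "\<And>j. j \<in> J \<Longrightarrow> (y j has_real_derivative y' j) (at t)"
    and "\<And>j. j \<in> J \<Longrightarrow> y j t \<noteq> 1"
  shows "((\<lambda>t. \<Prod>j\<in>J. 1 - y j t) has_real_derivative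
    - (\<Prod>j\<in>J. 1 - y j t) * (\<Sum>j\<in>J. y' j / (1 - y j t))) (at t)"
proof -
  have "((\<lambda>t. \<Prod>j\<in>J. 1 - y j t) has_real_derivative
      (\<Prod>j\<in>J. 1 - y j t) * (\<Sum>j\<in>J. (0 - y' j) / (1 - y j t))) (at t)"
    using assms by (intro has_field_derivative_prod' DERIV_diff DERIV_const) auto
  then show ?thesis
    by (simp add: sum_negf)
qed

text \<open>Normalization centers the logarithmic derivatives: with \<open>a\<close> the mean of
  \<open>s\<close> under the normalized weights, the new ones are \<open>a - s i\<close>. Their
  energy is the variance of \<open>s\<close>, hence at most its second moment. Writing derivatives
  as \<open>- Z i t * s i\<close> instead of dividing by \<open>Z i t\<close> lets weights
  vanish.\<close>

lemma normalized_derivative: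
  fixes Z :: "'c \<Rightarrow> real \<Rightarrow> real" and I :: "'c set"
  defines "S \<equiv> \<lambda>t. \<Sum>i\<in>I. Z i t"
  assumes fin: "finite I" and pos: "S t > 0" and nonneg: "\<And>i. i \<in> I \<Longrightarrow> 0 \<le> Z i t"
    and Z: "\<And>i. i \<in> I \<Longrightarrow> (Z i has_real_derivative - Z i t * s i) (at t)"
  shows "\<exists>g. (\<forall>i\<in>I. ((\<lambda>t. Z i t / S t) has_real_derivative Z i t / S t * g i) (at t))
    \<and> (\<Sum>i\<in>I. Z i t / S t * (g i)\<^sup>2) \<le> (\<Sum>i\<in>I. Z i t / S t * (s i)\<^sup>2)"
proof -
  define p where "p i = Z i t / S t" for i
  define a where "a = (\<Sum>i\<in>I. p i * s i)"
  have p1: "(\<Sum>i\<in>I. p i) = 1"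
  proof -
    have "(\<Sum>i\<in>I. p i) = S t / S t"
      unfolding p_def sum_divide_distrib[symmetric] S_def ..
    then show ?thesis
      using pos by simp
  qed
  have S': "(S has_real_derivative (\<Sum>i\<in>I. - Z i t * s i)) (at t)"
    unfolding S_def by (intro DERIV_sum Z)
  have a: "(\<Sum>i\<in>I. - Z i t * s i) = - S t * a"
  proof -
    have "S t * a = (\<Sum>i\<in>I. Z i t * s i)"
      unfolding a_def p_def sum_distrib_left using pos by (intro sum.cong) auto
    then show ?thesis
      by (simp add: sum_negf)
  qed
  have "((\<lambda>t. Z i t / S t) has_real_derivative p i * (a - s i)) (at t)" if i: "i \<in> I" for i
  proof -
    have "((\<lambda>t. Z i t / S t) has_real_derivative
        (- Z i t * s i * S t - Z i t * (- S t * a)) / (S t * S t)) (at t)"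
      using DERIV_divide[OF Z[OF i] S'] pos unfolding a by simp
    moreover have "(- Z i t * s i * S t - Z i t * (- S t * a)) / (S t * S t) = p i * (a - s i)"
      using pos by (simp add: p_def field_simps)
    ultimately show ?thesis by simp
  qed
  moreover have "(\<Sum>i\<in>I. p i * (a - s i)\<^sup>2) \<le> (\<Sum>i\<in>I. p i * (s i)\<^sup>2)"
  proof -
    \<comment> \<open>The variance is the second moment minus the square of the mean.\<close>
    have "(\<Sum>i\<in>I. p i * (a - s i)\<^sup>2) = (\<Sum>i\<in>I. a\<^sup>2 * p i - 2 * a * (p i * s i) + p i * (s i)\<^sup>2)"
      by (intro sum.cong) (auto simp: power2_eq_square algebra_simps)
    also have "\<dots> = a\<^sup>2 * (\<Sum>i\<in>I. p i) - 2 * a * a + (\<Sum>i\<in>I. p i * (s i)\<^sup>2)"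
      unfolding sum.distrib sum_subtractf sum_distrib_left[symmetric] a_def[symmetric] ..
    also have "\<dots> = (\<Sum>i\<in>I. p i * (s i)\<^sup>2) - a\<^sup>2"
      unfolding p1 by (simp add: power2_eq_square)
    finally show ?thesis by simp
  qed
  ultimately show ?thesis
    unfolding p_def by (intro exI[of _ "\<lambda>i. a - s i"]) auto
qed

section \<open>Reduced walks and branches\<close>

text \<open>These are the walks that never turn straight back. In an acyclic graph they have no
  repeated vertex, which makes them a tool for separating the branches of a tree.\<close>

fun reduced_walk :: "('v \<times> 'v) set \<Rightarrow> 'v list \<Rightarrow> bool" where
  "reduced_walk E [] \<longleftrightarrow> True"
| "reduced_walk E [x] \<longleftrightarrow> True"
| "reduced_walk E [x, y] \<longleftrightarrow> (x, y) \<in> E"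
| "reduced_walk E (x # y # z # zs) \<longleftrightarrow> (x, y) \<in> E \<and> x \<noteq> z \<and> reduced_walk E (y # z # zs)"

text \<open>An overlap of two vertices is required: then every three consecutive vertices of the
  joined walk lie in one of the two pieces.\<close>

lemma reduced_walk_glue:
  "reduced_walk E (xs @ [a, b]) \<Longrightarrow> reduced_walk E (a # b # ys) \<Longrightarrow> reduced_walk E (xs @ a # b # ys)"
  by (induction E xs rule: reduced_walk.induct) auto

lemma reduced_walk_hd: "reduced_walk E (x # y # zs) \<Longrightarrow> (x, y) \<in> E"
  by (cases zs) auto

lemma reduced_walk_rev:
  "reduced_walk E xs \<Longrightarrow> sym E \<Longrightarrow> reduced_walk E (rev xs)"
proof (induction E xs rule: reduced_walk.induct)
  case (3 E x y)
  then show ?case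
    using symD[OF 3(2)] by simp
next
  case (4 E x y z zs)
  then have "reduced_walk E (rev zs @ [z, y])" "reduced_walk E [z, y, x]"
    using symD[OF 4(3)] reduced_walk_hd[of E y z zs] by auto
  then have "reduced_walk E (rev zs @ z # y # [x])"
    by (rule reduced_walk_glue)
  then show ?case by simp
qed auto

lemma reduced_walk_edge:
  "reduced_walk E xs \<Longrightarrow> Suc i < length xs \<Longrightarrow> (xs ! i, xs ! Suc i) \<in> E"
proof (induction E xs arbitrary: i rule: reduced_walk.induct)
  case (4 E x y z zs)
  then show ?case by (cases i) auto
qed auto

lemma cycle_of_closed_path:
  assumes "reduced_walk E xs" "distinct xs" "3 \<le> length xs" "(last xs, hd xs) \<in> E"
  shows "graph_cycle E xs"
  unfolding graph_cycle_def
proof (intro conjI allI impI assms)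
  fix i assume i: "i < length xs"
  show "(xs ! i, xs ! (Suc i mod length xs)) \<in> E"
  proof (cases "Suc i < length xs")
    case True
    then show ?thesis
      using reduced_walk_edge[OF assms(1), of i] by simp
  next
    case False
    then have "i = length xs - 1" "xs \<noteq> []"
      using i by auto
    then show ?thesis
      using assms(4) i by (simp add: last_conv_nth hd_conv_nth)
  qed
qed

lemma reduced_walk_take:
  "reduced_walk E xs \<Longrightarrow> reduced_walk E (take n xs)"
proof (induction E xs arbitrary: n rule: reduced_walk.induct)
  case (3 E x y)
  then show ?case by (cases n; cases "n - 1") auto
next
  case (4 E x y z zs)
  show ?case
  proof (cases "n \<le> 2")
    case True
    then consider "n = 0" | "n = 1" | "n = 2" by linarith
    then show ?thesis using 4 by cases (auto simp: numeral_2_eq_2)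
  next
    case False
    then obtain k where "n = Suc (Suc (Suc k))"
      by (metis Suc_le_D numeral_2_eq_2 not_less_eq_eq)
    then show ?thesis using 4(1)[of "Suc (Suc k)"] 4(2) by auto
  qed
qed (auto simp: take_Cons')

text \<open>If the first vertex reappears, the part of the walk before its reappearance closes up to
  a cycle. The tail has no repetitions by induction, and the closed part is long enough because
  loops and immediate returns are excluded.\<close>

lemma reduced_walk_distinct:
  assumes "irrefl E" and acyclic: "\<nexists>xs. graph_cycle E xs"
  shows "reduced_walk E xs \<Longrightarrow> distinct xs"
proof (induction xs)
  case (Cons a ys)
  have ys: "reduced_walk E ys"
    using Cons.prems by (cases ys; cases "tl ys") auto
  then have "distinct ys"
    by (rule Cons.IH)
  moreover have "a \<notin> set ys"
  proof
    assume "a \<in> set ys"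
    then obtain j where j: "j < length ys" "ys ! j = a"
      by (auto simp: in_set_conv_nth)
    \<comment> \<open>The walk is cut just before \<open>a\<close> reappears; this list has
      \<open>j + 1\<close> vertices, so \<open>2 \<le> j\<close> is needed for a cycle.\<close>
    let ?c = "a # take j ys"
    have edge: "((a # ys) ! j, (a # ys) ! Suc j) \<in> E"
      using Cons.prems j by (intro reduced_walk_edge) auto
    have "j \<noteq> 0"
    proof
      assume "j = 0"
      then show False
        using edge j assms(1) by (simp add: irrefl_def)
    qed
    \<comment> \<open>This would be an immediate return to \<open>a\<close>.\<close>
    moreover have "j \<noteq> 1"
      using Cons.prems j by (cases ys; cases "tl ys") auto
    ultimately have "2 \<le> j" by simp
    have "a \<notin> set (take j ys)"
    proof
      assume "a \<in> set (take j ys)"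
      then obtain k where "k < j" "ys ! k = a"
        using j by (auto simp: in_set_conv_nth)
      then show False
        using \<open>distinct ys\<close> j by (auto simp: nth_eq_iff_index_eq)
    qed
    then have "distinct ?c"
      using \<open>distinct ys\<close> by simp
    moreover have "reduced_walk E ?c"
      using reduced_walk_take[OF Cons.prems, of "Suc j"] by simp
    moreover have "last ?c = (a # ys) ! j"
      using \<open>2 \<le> j\<close> j by (subst last_conv_nth) (auto simp: nth_Cons')
    ultimately have "graph_cycle E ?c"
      using edge \<open>2 \<le> j\<close> j by (intro cycle_of_closed_path) auto
    then show False
      using acyclic by blast
  qed
  ultimately show ?case by simp
qed simp

text \<open>\<open>u\<close> is the parent of \<open>w\<close>. At the root we take \<open>u = w\<close>, which removes nothing since \<open>w\<close> is not its
  own neighbour.\<close>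

primrec free_region :: "('v \<times> 'v) set \<Rightarrow> 'v set \<Rightarrow> nat \<Rightarrow> 'v \<Rightarrow> 'v \<Rightarrow> 'v set" where
  "free_region E W 0 u w = {}"
| "free_region E W (Suc n) u w =
    (if w \<in> W then {} else insert w (\<Union>x\<in>E `` {w} - {u}. free_region E W n w x))"

text \<open>Each descent goes to a child other than the parent, so it is a reduced walk. Putting the
  parent \<open>u\<close> in front records this condition for the first step as well.\<close>

lemma free_region_walk:
  "a \<in> free_region E W n u w \<Longrightarrow> (u, w) \<in> E \<Longrightarrow>
    \<exists>zs. reduced_walk E (u # w # zs) \<and> last (w # zs) = a"
proof (induction n arbitrary: u w)
  case (Suc n)
  show ?case
  proof (cases "a = w")
    case True
    then show ?thesis
      using Suc.prems by (intro exI[of _ "[]"]) auto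
  next
    case False
    then obtain x where x: "(w, x) \<in> E" "x \<noteq> u" "a \<in> free_region E W n w x"
      using Suc.prems by (auto split: if_splits)
    from Suc.IH[OF x(3,1)] obtain zs where "reduced_walk E (w # x # zs)" "last (x # zs) = a"
      by blast
    then show ?thesis
      using Suc.prems x by (intro exI[of _ "x # zs"]) auto
  qed
qed simp

text \<open>The bound is strict, since depth \<open>n\<close> counts the vertex \<open>w\<close>
  itself. A region of depth \<open>n\<close> thus avoids every vertex at distance \<open>n\<close>
  or more.\<close>

lemma free_region_relpow:
  "a \<in> free_region E W n u w \<Longrightarrow> \<exists>m<n. (w, a) \<in> E ^^ m"
proof (induction n arbitrary: u w)
  case (Suc n)
  show ?case
  proof (cases "a = w")
    case False
    then obtain x where x: "(w, x) \<in> E" "a \<in> free_region E W n w x"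
      using Suc.prems by (auto split: if_splits)
    then obtain m where "m < n" "(x, a) \<in> E ^^ m"
      using Suc.IH by blast
    then show ?thesis
      using x by (intro exI[of _ "Suc m"] conjI relpow_Suc_I2) auto
  qed (auto intro!: exI[of _ 0])
qed simp

lemma free_region_disjoint: "a \<in> free_region E W n u w \<Longrightarrow> a \<notin> W"
  by (induction n arbitrary: u w) (auto split: if_splits)

lemma finite_free_region:
  "(\<And>w. finite (E `` {w})) \<Longrightarrow> finite (free_region E W n u w)"
  by (induction n arbitrary: u w) auto

lemma free_region_subset:
  "E \<subseteq> V \<times> V \<Longrightarrow> w \<in> V \<Longrightarrow> free_region E W n u w \<subseteq> V"
proof (induction n arbitrary: u w)
  case (Suc n)
  have "free_region E W n w x \<subseteq> V" if "x \<in> E `` {w}" for x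
    using Suc that by (intro Suc.IH) auto
  then show ?case
    using Suc.prems by auto
qed auto

text \<open>Otherwise the descent from \<open>w\<close> to itself would be a reduced walk with a
  repetition.\<close>

lemma root_notin_branch:
  assumes "irrefl E" "\<nexists>xs. graph_cycle E xs" "(w, x) \<in> E"
  shows "w \<notin> free_region E W n w x"
proof
  assume "w \<in> free_region E W n w x"
  then obtain zs where zs: "reduced_walk E (w # x # zs)" "last (x # zs) = w"
    using free_region_walk assms(3) by metis
  then have "distinct (w # x # zs)" "last (x # zs) \<in> set (x # zs)"
    using reduced_walk_distinct[OF assms(1,2)] by (blast, intro last_in_set) simp
  then show False
    unfolding zs(2) by simp
qed

text \<open>Climb from \<open>a\<close> through \<open>x\<close> to \<open>w\<close>, then descend
  through \<open>x'\<close> to \<open>a'\<close>. The bound on the length holds because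
  \<open>w\<close> lies strictly between the two ends.\<close>

lemma branch_walk:
  assumes "sym E" and "(w, x) \<in> E" "(w, x') \<in> E" "x \<noteq> x'"
    and "a \<in> free_region E W n w x" "a' \<in> free_region E W n w x'"
  shows "\<exists>ys. reduced_walk E (a # ys) \<and> length ys \<ge> 2 \<and> last ys = a'"
proof -
  obtain zs where zs: "reduced_walk E (w # x # zs)" "last (x # zs) = a"
    using free_region_walk assms by metis
  obtain zs' where zs': "reduced_walk E (w # x' # zs')" "last (x' # zs') = a'"
    using free_region_walk assms by metis
  have 1: "reduced_walk E (rev zs @ [x, w])"
    using reduced_walk_rev[OF zs(1) assms(1)] by simp
  \<comment> \<open>Passing over \<open>w\<close> is no backtracking because
    \<open>x \<noteq> x'\<close>.\<close>
  have "reduced_walk E (rev zs @ x # w # [x'])"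
    using assms symD[OF assms(1,2)] by (intro reduced_walk_glue[OF 1]) auto
  then have "reduced_walk E ((rev zs @ [x]) @ [w, x'])" by simp
  from reduced_walk_glue[OF this zs'(1)]
  have 2: "reduced_walk E (rev (x # zs) @ w # x' # zs')" by simp
  have "rev (x # zs) = a # tl (rev (x # zs))"
    using zs(2) by (metis hd_rev list.collapse rev_is_Nil_conv list.distinct(1))
  then have "reduced_walk E (a # tl (rev (x # zs)) @ w # x' # zs')"
    using 2 by (metis append_Cons)
  then show ?thesis
    using zs' by (intro exI[of _ "tl (rev (x # zs)) @ w # x' # zs'"]) auto
qed

text \<open>A common vertex would be both ends of a reduced walk, which cannot repeat a
  vertex.\<close>

lemma branches_disjoint:
  assumes "sym E" "irrefl E" "\<nexists>xs. graph_cycle E xs"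
    and "(w, x) \<in> E" "(w, x') \<in> E" "x \<noteq> x'"
  shows "free_region E W n w x \<inter> free_region E W n w x' = {}"
proof (rule ccontr)
  assume "\<not> ?thesis"
  then obtain a where "a \<in> free_region E W n w x" "a \<in> free_region E W n w x'" by blast
  from branch_walk[OF assms(1,4,5,6) this] obtain ys where
    ys: "reduced_walk E (a # ys)" "length ys \<ge> 2" "last ys = a" by blast
  then have "distinct (a # ys)" "a \<in> set ys"
    using reduced_walk_distinct[OF assms(2,3) ys(1)] last_in_set[of ys] by fastforce+
  then show False by simp
qed

text \<open>Such an edge would close the walk over \<open>w\<close> to a cycle.\<close>

lemma no_edge_between_branches:
  assumes "sym E" "irrefl E" "\<nexists>xs. graph_cycle E xs"
    and "(w, x) \<in> E" "(w, x') \<in> E" "x \<noteq> x'"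
    and "a \<in> free_region E W n w x" "a' \<in> free_region E W n w x'"
  shows "(a, a') \<notin> E"
proof
  assume "(a, a') \<in> E"
  obtain ys where ys: "reduced_walk E (a # ys)" "length ys \<ge> 2" "last ys = a'"
    using branch_walk[OF assms(1,4-8)] by blast
  have "distinct (a # ys)"
    using reduced_walk_distinct[OF assms(2,3) ys(1)] .
  then have "graph_cycle E (a # ys)"
    using ys symD[OF assms(1) \<open>(a, a') \<in> E\<close>] by (intro cycle_of_closed_path) auto
  then show False
    using assms(3) by blast
qed

text \<open>Such an edge would close the descent from \<open>w\<close> to \<open>a\<close> to a
  cycle, of length at least three because \<open>a\<close> lies below \<open>x\<close>.\<close>

lemma no_edge_to_root:
  assumes "sym E" "irrefl E" "\<nexists>xs. graph_cycle E xs"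
    and "(w, x) \<in> E" "a \<in> free_region E W n w x" "a \<noteq> x"
  shows "(a, w) \<notin> E"
proof
  assume "(a, w) \<in> E"
  obtain zs where zs: "reduced_walk E (w # x # zs)" "last (x # zs) = a"
    using free_region_walk assms by metis
  have "distinct (w # x # zs)"
    using reduced_walk_distinct[OF assms(2,3) zs(1)] .
  moreover have "zs \<noteq> []"
    using zs assms by auto
  then have "length (w # x # zs) \<ge> 3"
    by (cases zs) auto
  ultimately have "graph_cycle E (w # x # zs)"
    using zs \<open>(a, w) \<in> E\<close> by (intro cycle_of_closed_path) auto
  then show False
    using assms(3) by blast
qed

section \<open>Counting colorings of a branch\<close>

text \<open>Edges that do not meet \<open>F\<close> are left out, as they see only boundary colors.
  The exempt edge \<open>e\<close> is oriented, with its end in \<open>F\<close> first.\<close>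

definition proper_at :: "('v \<times> 'v) set \<Rightarrow> 'v set \<Rightarrow> 'v \<times> 'v \<Rightarrow> ('v \<Rightarrow> nat) \<Rightarrow> bool" where
  "proper_at E F e \<rho> \<longleftrightarrow> (\<forall>a\<in>F. \<forall>y. (a, y) \<in> E \<and> (a, y) \<noteq> e \<longrightarrow> \<rho> a \<noteq> \<rho> y)"

text \<open>The edge from \<open>w\<close> to its parent \<open>u\<close> is exempt from being proper; this makes the colorings of the
  branches at the children of \<open>w\<close> independent once the color of \<open>w\<close> is fixed.\<close>

definition branch_colorings ::
    "('v \<times> 'v) set \<Rightarrow> 'v set \<Rightarrow> nat \<Rightarrow> ('v \<Rightarrow> nat) \<Rightarrow> nat \<Rightarrow> 'v \<Rightarrow> 'v \<Rightarrow> nat \<Rightarrow> ('v \<Rightarrow> nat) set" where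
  "branch_colorings E W q \<omega> n u w i = (let F = free_region E W n u w in
     {\<tau> \<in> F \<rightarrow>\<^sub>E {1..q}. override_on \<omega> \<tau> F w = i \<and> proper_at E F (w, u) (override_on \<omega> \<tau> F)})"

locale locally_finite_tree =
  fixes V :: "'v set" and E :: "('v \<times> 'v) set"
  assumes tree: "is_tree V E" and finite_neighbours: "\<And>w. finite (E `` {w})"
begin

lemma edges_subset: "E \<subseteq> V \<times> V" and sym_E: "sym E" and irrefl_E: "irrefl E"
  and no_cycle: "\<nexists>xs. graph_cycle E xs"
  using tree by (auto simp: is_tree_def simple_graph_def)

lemma not_loop: "(x, x) \<notin> E"
  using irrefl_E by (auto simp: irrefl_def)

lemma edge_sym: "(x, y) \<in> E \<Longrightarrow> (y, x) \<in> E"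
  using sym_E by (auto dest: symD)

lemma finite_branch_colorings: "finite (branch_colorings E W q \<omega> n u w i)"
proof -
  have "finite (free_region E W n u w \<rightarrow>\<^sub>E {1..q})"
    using finite_free_region[OF finite_neighbours] by (intro finite_PiE) auto
  then show ?thesis
    unfolding branch_colorings_def Let_def by (rule finite_subset[rotated]) auto
qed

text \<open>Once \<open>w\<close> has color \<open>i\<close>, the branches at its children are
  colored independently: they are disjoint, no edge joins two of them, and each meets
  \<open>w\<close> only through its child. The exempt edge of a child leads to \<open>w\<close>, so
  its constraint is imposed separately by excluding the color \<open>i\<close>.\<close>

lemma card_branch_colorings_Suc:
  fixes W q \<omega> n u w i
  assumes \<omega>: "\<omega> \<in> V \<rightarrow> {1..q}" and w: "w \<notin> W" and i: "i \<in> {1..q}"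
  shows "card (branch_colorings E W q \<omega> (Suc n) u w i) =
    (\<Prod>x\<in>E `` {w} - {u}. \<Sum>j\<in>{1..q}-{i}. card (branch_colorings E W q \<omega> n w x j))"
proof -
  define C where "C = E `` {w} - {u}"
  define f where "f x = free_region E W n w x" for x
  define F where "F = insert w (\<Union>x\<in>C. f x)"
  define S where "S x = (\<Union>j\<in>{1..q}-{i}. branch_colorings E W q \<omega> n w x j)" for x
  have F: "free_region E W (Suc n) u w = F"
    using w by (simp add: F_def f_def C_def)
  have C: "(w, x) \<in> E" "(x, w) \<in> E" "x \<in> V" "x \<noteq> w" if "x \<in> C" for x
    using that edge_sym edges_subset not_loop by (auto simp: C_def)
  have wf: "w \<notin> f x" if "x \<in> C" for x
    unfolding f_def using root_notin_branch[OF irrefl_E no_cycle C(1)[OF that]] .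
  have disj: "x = x'" if "a \<in> f x" "a \<in> f x'" "x \<in> C" "x' \<in> C" for a x x'
    using branches_disjoint[OF sym_E irrefl_E no_cycle C(1)[OF that(3)] C(1)[OF that(4)], of W n] that
    by (auto simp: f_def)
  have no_edge: "(a, a') \<notin> E" if "a \<in> f x" "a' \<in> f x'" "x \<noteq> x'" "x \<in> C" "x' \<in> C" for a a' x x'
    using no_edge_between_branches[OF sym_E irrefl_E no_cycle C(1) C(1), of x x'] that
    by (auto simp: f_def)
  have no_root: "(a, w) \<notin> E" if "a \<in> f x" "a \<noteq> x" "x \<in> C" for a x
    using no_edge_to_root[OF sym_E irrefl_E no_cycle C(1), of x a W n] that by (auto simp: f_def)
  \<comment> \<open>A child cannot lie deeper in the branch of another child. So a child outside its
    own branch lies outside the whole region and keeps its color under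
    \<open>\<omega>\<close>.\<close>
  have child: "x \<in> f x" if "x \<in> C" "x \<in> F" for x
    using that C[OF that(1)] no_root by (fastforce simp: F_def)
  have S: "S x = {\<tau> \<in> f x \<rightarrow>\<^sub>E {1..q}. override_on \<omega> \<tau> (f x) x \<noteq> i
      \<and> proper_at E (f x) (x, w) (override_on \<omega> \<tau> (f x))}" if "x \<in> C" for x
  proof -
    have "override_on \<omega> \<tau> (f x) x \<in> {1..q}" if "\<tau> \<in> f x \<rightarrow>\<^sub>E {1..q}" for \<tau>
      using that \<omega> C(3)[OF \<open>x \<in> C\<close>] by (cases "x \<in> f x") auto
    then show ?thesis
      by (auto simp: S_def branch_colorings_def f_def Let_def)
  qed
  \<comment> \<open>A coloring of the region is proper exactly if its restrictions to the branches
    are.\<close>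
  have colorings_iff: "\<tau> \<in> branch_colorings E W q \<omega> (Suc n) u w i \<longleftrightarrow>
      \<tau> w = i \<and> (\<forall>x\<in>C. restrict \<tau> (f x) \<in> S x)" if \<tau>: "\<tau> \<in> F \<rightarrow>\<^sub>E {1..q}" for \<tau>
  proof -
    let ?\<rho> = "override_on \<omega> \<tau> F"
    let ?\<rho>x = "\<lambda>x. override_on \<omega> (restrict \<tau> (f x)) (f x)"
    have \<rho>x: "?\<rho>x x y = ?\<rho> y" if "x \<in> C" "y \<in> f x \<or> y \<notin> F" for x y
      using that by (cases "y \<in> f x") (auto simp: F_def override_on_def)
    have \<rho>xx: "?\<rho>x x x = ?\<rho> x" if "x \<in> C" for x
      using \<rho>x[OF that] child[OF that] by blast
    \<comment> \<open>Apart from the exempt edge, neighbours of a branch stay in the branch or leave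
      the region; there the extensions of \<open>\<tau>\<close> and of its restriction
      agree.\<close>
    have nb: "y \<in> f x \<or> y \<notin> F" if "a \<in> f x" "(a, y) \<in> E" "(a, y) \<noteq> (x, w)" "x \<in> C" for a x y
      using that no_root no_edge by (fastforce simp: F_def)
    have \<rho>w: "?\<rho> w = \<tau> w"
      by (simp add: F_def)
    have restr: "restrict \<tau> (f x) \<in> f x \<rightarrow>\<^sub>E {1..q}" if "x \<in> C" for x
      using \<tau> that by (auto simp: F_def)
    have "proper_at E F (w, u) ?\<rho> \<longleftrightarrow>
        (\<forall>x\<in>C. ?\<rho>x x x \<noteq> i \<and> proper_at E (f x) (x, w) (?\<rho>x x))" (is "?L \<longleftrightarrow> ?R") if "\<tau> w = i"
    proof
      assume L: ?L
      show ?R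
      proof (intro ballI conjI)
        fix x assume x: "x \<in> C"
        then have "?\<rho> w \<noteq> ?\<rho> x"
          using L C(1)[OF x] by (auto simp: proper_at_def F_def C_def)
        then show "?\<rho>x x x \<noteq> i"
          using \<rho>xx[OF x] \<rho>w that by simp
        show "proper_at E (f x) (x, w) (?\<rho>x x)"
          unfolding proper_at_def
        proof (intro ballI allI impI)
          fix a y assume a: "a \<in> f x" and y: "(a, y) \<in> E \<and> (a, y) \<noteq> (x, w)"
          have "a \<in> F" "(a, y) \<noteq> (w, u)"
            using a x wf[OF x] by (auto simp: F_def)
          then have "?\<rho> a \<noteq> ?\<rho> y"
            using L y unfolding proper_at_def by blast
          then show "?\<rho>x x a \<noteq> ?\<rho>x x y"
            using \<rho>x[OF x, of a] \<rho>x[OF x, of y] nb[OF a _ _ x, of y] a y by auto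
        qed
      qed
    next
      assume R: ?R
      show ?L
        unfolding proper_at_def
      proof (intro ballI allI impI)
        fix a y assume a: "a \<in> F" and y: "(a, y) \<in> E \<and> (a, y) \<noteq> (w, u)"
        show "?\<rho> a \<noteq> ?\<rho> y"
        proof (cases "a = w")
          case True
          then have "y \<in> C"
            using y by (auto simp: C_def)
          then show ?thesis
            using True R \<rho>xx[of y] \<rho>w that by auto
        next
          case False
          then obtain x where x: "x \<in> C" "a \<in> f x"
            using a by (auto simp: F_def)
          show ?thesis
          proof (cases "(a, y) = (x, w)")
            case True
            then show ?thesis
              using R x \<rho>xx[of x] \<rho>w that by auto
          next
            case False
            then have "?\<rho>x x a \<noteq> ?\<rho>x x y"
              using R x y by (auto simp: proper_at_def)
            then show ?thesis
              using \<rho>x[OF x(1), of a] \<rho>x[OF x(1), of y] nb[OF x(2) _ False x(1)] x y by auto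
          qed
        qed
      qed
    qed
    then show ?thesis
      using \<tau> \<rho>w restr unfolding branch_colorings_def Let_def F by (auto simp: S)
  qed
  define h where "h \<tau> = (\<lambda>x\<in>C. restrict \<tau> (f x))" for \<tau> :: "'v \<Rightarrow> nat"
  have "bij_betw h (branch_colorings E W q \<omega> (Suc n) u w i) (Pi\<^sub>E C S)"
    unfolding bij_betw_def
  proof
    have sub: "branch_colorings E W q \<omega> (Suc n) u w i \<subseteq> F \<rightarrow>\<^sub>E {1..q}"
      unfolding branch_colorings_def F Let_def by auto
    show "inj_on h (branch_colorings E W q \<omega> (Suc n) u w i)"
    proof (rule inj_onI)
      fix \<tau> \<tau>'
      assume t: "\<tau> \<in> branch_colorings E W q \<omega> (Suc n) u w i"
        "\<tau>' \<in> branch_colorings E W q \<omega> (Suc n) u w i" and eq: "h \<tau> = h \<tau>'"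
      have PE: "\<tau> \<in> F \<rightarrow>\<^sub>E {1..q}" "\<tau>' \<in> F \<rightarrow>\<^sub>E {1..q}"
        using t sub by auto
      show "\<tau> = \<tau>'"
      proof (rule PiE_ext[OF PE])
        fix a assume "a \<in> F"
        then consider "a = w" | x where "x \<in> C" "a \<in> f x"
          by (auto simp: F_def)
        then show "\<tau> a = \<tau>' a"
        proof cases
          case 1
          then show ?thesis
            using t colorings_iff PE by auto
        next
          case 2
          then have "restrict \<tau> (f x) a = restrict \<tau>' (f x) a"
            using eq unfolding h_def by (metis restrict_apply')
          then show ?thesis
            using 2 by simp
        qed
      qed
    qed
    show "h ` branch_colorings E W q \<omega> (Suc n) u w i = Pi\<^sub>E C S"
    proof
      show "h ` branch_colorings E W q \<omega> (Suc n) u w i \<subseteq> Pi\<^sub>E C S"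
        using colorings_iff sub by (auto simp: h_def)
      show "Pi\<^sub>E C S \<subseteq> h ` branch_colorings E W q \<omega> (Suc n) u w i"
      proof
        fix g assume g: "g \<in> Pi\<^sub>E C S"
        \<comment> \<open>The inverse of \<open>h\<close>: the branch colorings are glued, each
          vertex taking its color from the unique branch that contains it.\<close>
        define \<tau> where "\<tau> = (\<lambda>a\<in>F. if a = w then i else g (THE x. x \<in> C \<and> a \<in> f x) a)"
        have \<tau>f: "\<tau> a = g x a" if "x \<in> C" "a \<in> f x" for a x
        proof -
          have "(THE x. x \<in> C \<and> a \<in> f x) = x"
            using that disj by (intro the_equality) auto
          moreover have "a \<noteq> w" "a \<in> F"
            using that wf by (auto simp: F_def)
          ultimately show ?thesis
            by (simp add: \<tau>_def)
        qed
        have gx: "g x \<in> f x \<rightarrow>\<^sub>E {1..q}" if "x \<in> C" for x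
          using PiE_mem[OF g that] S[OF that] by blast
        have restr: "restrict \<tau> (f x) = g x" if "x \<in> C" for x
          using PiE_restrict[OF gx[OF that]] \<tau>f[OF that] by (metis restrict_ext)
        have "\<tau> \<in> F \<rightarrow>\<^sub>E {1..q}"
        proof (rule PiE_I)
          fix a assume "a \<in> F"
          then consider "a = w" | x where "x \<in> C" "a \<in> f x"
            by (auto simp: F_def)
          then show "\<tau> a \<in> {1..q}"
          proof cases
            case 1
            then show ?thesis
              using i by (simp add: \<tau>_def F_def)
          next
            case 2
            then show ?thesis
              using \<tau>f[OF 2] gx[OF 2(1)] by auto
          qed
        qed (simp add: \<tau>_def)
        moreover have "\<tau> w = i"
          by (simp add: \<tau>_def F_def)
        ultimately have "\<tau> \<in> branch_colorings E W q \<omega> (Suc n) u w i"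
          using colorings_iff restr g by (auto dest: PiE_mem)
        moreover have "g = h \<tau>"
        proof (rule PiE_ext[OF g])
          show "h \<tau> \<in> Pi\<^sub>E C S"
            using restr g by (auto simp: h_def dest: PiE_mem)
          fix x assume "x \<in> C"
          then show "g x = h \<tau> x"
            using restr by (simp add: h_def)
        qed
        ultimately show "g \<in> h ` branch_colorings E W q \<omega> (Suc n) u w i"
          by blast
      qed
    qed
  qed
  then have "card (branch_colorings E W q \<omega> (Suc n) u w i) = card (Pi\<^sub>E C S)"
    by (rule bij_betw_same_card)
  also have "\<dots> = (\<Prod>x\<in>C. card (S x))"
    using finite_neighbours by (intro card_PiE) (simp add: C_def)
  \<comment> \<open>The union in \<open>S x\<close> is disjoint because \<open>j\<close> is
    determined as the color of \<open>x\<close>.\<close>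
  also have "\<dots> = (\<Prod>x\<in>C. \<Sum>j\<in>{1..q}-{i}. card (branch_colorings E W q \<omega> n w x j))"
    unfolding S_def
    by (intro prod.cong card_UN_disjoint ballI finite_branch_colorings refl impI)
      (auto simp: branch_colorings_def Let_def)
  finally show ?thesis
    by (simp add: C_def)
qed

text \<open>Covers both ways the recursion stops, at depth 0 and at a vertex of \<open>W\<close>:
  the color of \<open>w\<close> is then read off \<open>\<omega>\<close>.\<close>

lemma branch_colorings_leaf:
  assumes "free_region E W n u w = {}"
  shows "card (branch_colorings E W q \<omega> n u w i) = of_bool (i = \<omega> w)"
  using assms by (auto simp: branch_colorings_def proper_at_def)

text \<open>A witness that some coloring of the branch exists, which makes the normalizers
  positive.\<close>

lemma restrict_mem_branch_colorings:
  assumes "\<omega> \<in> colorings V E q" "w \<in> V"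
  shows "restrict \<omega> (free_region E W n u w) \<in> branch_colorings E W q \<omega> n u w (\<omega> w)"
proof -
  let ?F = "free_region E W n u w"
  have "override_on \<omega> (restrict \<omega> ?F) ?F = \<omega>"
    by (auto simp: override_on_def)
  moreover have "?F \<subseteq> V"
    using free_region_subset[OF edges_subset assms(2)] .
  ultimately show ?thesis
    using assms(1) by (auto simp: branch_colorings_def Let_def proper_at_def colorings_def)
qed

end

section \<open>The message recursion\<close>

text \<open>The message is the law of the color of \<open>w\<close> in its branch after deletion of
  the edge to \<open>u\<close>. The values at depth 0 are an arbitrary real-valued family
  \<open>\<beta>\<close>, so that boundary conditions can be interpolated.\<close>

primrec message ::
    "('v \<times> 'v) set \<Rightarrow> 'v set \<Rightarrow> nat \<Rightarrow> ('v \<Rightarrow> nat) \<Rightarrow> ('v \<Rightarrow> 'v \<Rightarrow> nat \<Rightarrow> real) \<Rightarrow>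
      nat \<Rightarrow> 'v \<Rightarrow> 'v \<Rightarrow> nat \<Rightarrow> real" where
  "message E W q \<sigma> \<beta> 0 u w = \<beta> u w"
| "message E W q \<sigma> \<beta> (Suc n) u w = (\<lambda>i. if w \<in> W then of_bool (i = \<sigma> w) else
     (\<Prod>x\<in>E `` {w} - {u}. 1 - message E W q \<sigma> \<beta> n w x i)
       / (\<Sum>l\<in>{1..q}. \<Prod>x\<in>E `` {w} - {u}. 1 - message E W q \<sigma> \<beta> n w x l))"

text \<open>The lowest \<open>k\<close> levels can be absorbed into the boundary values.\<close>

lemma message_add: "message E W q \<sigma> \<beta> (n + k) = message E W q \<sigma> (message E W q \<sigma> \<beta> k) n"
  by (induction n) (auto simp: fun_eq_iff)

definition point_masses :: "('v \<Rightarrow> nat) \<Rightarrow> 'v \<Rightarrow> 'v \<Rightarrow> nat \<Rightarrow> real" where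
  "point_masses \<omega> u w i = of_bool (i = \<omega> w)"

text \<open>In the recursion for the counts, each child contributes its total count times
  \<open>1 - M x i\<close>. The totals do not depend on the color of \<open>w\<close> and cancel on
  normalization.\<close>

lemma (in locally_finite_tree) card_branch_colorings_message:
  assumes \<omega>: "\<omega> \<in> colorings V E q" and W: "\<And>w. w \<in> W \<Longrightarrow> \<omega> w = \<sigma> w"
  defines "N \<equiv> \<lambda>n u w i. real (card (branch_colorings E W q \<omega> n u w i))"
  shows "w \<in> V \<Longrightarrow> (\<Sum>i\<in>{1..q}. N n u w i) > 0 \<and>
    (\<forall>i\<in>{1..q}. N n u w i = (\<Sum>l\<in>{1..q}. N n u w l) * message E W q \<sigma> (point_masses \<omega>) n u w i)"
proof (induction n arbitrary: u w)
  case 0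
  then have "\<omega> w \<in> {1..q}"
    using \<omega> by (auto simp: colorings_def)
  moreover have "N 0 u w i = of_bool (i = \<omega> w)" for i
    unfolding N_def by (subst branch_colorings_leaf) auto
  ultimately show ?case
    by (auto simp: point_masses_def of_bool_def)
next
  case (Suc n)
  have \<omega>w: "\<omega> w \<in> {1..q}" and \<omega>V: "\<omega> \<in> V \<rightarrow> {1..q}"
    using \<omega> Suc.prems by (auto simp: colorings_def)
  show ?case
  proof (cases "w \<in> W")
    case True
    then have "N (Suc n) u w i = of_bool (i = \<sigma> w)" for i
      unfolding N_def by (subst branch_colorings_leaf) (auto simp: W)
    then show ?thesis
      using \<omega>w True W by (auto simp: of_bool_def)
  next
    case False
    define C where "C = E `` {w} - {u}"
    define M where "M x i = message E W q \<sigma> (point_masses \<omega>) n w x i" for x i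
    define T where "T x = (\<Sum>i\<in>{1..q}. N n w x i)" for x
    define P where "P i = (\<Prod>x\<in>C. 1 - M x i)" for i
    have C: "x \<in> V" if "x \<in> C" for x
      using that edges_subset by (auto simp: C_def)
    have IH: "T x > 0" "\<And>i. i \<in> {1..q} \<Longrightarrow> N n w x i = T x * M x i" if "x \<in> C" for x
      using Suc.IH[OF C[OF that], of w] by (auto simp: T_def M_def)
    have prod: "N (Suc n) u w i = (\<Prod>x\<in>C. T x) * P i" if i: "i \<in> {1..q}" for i
    proof -
      have "N (Suc n) u w i = (\<Prod>x\<in>C. \<Sum>j\<in>{1..q}-{i}. N n w x j)"
        unfolding N_def card_branch_colorings_Suc[OF \<omega>V False i] C_def by simp
      also have "\<dots> = (\<Prod>x\<in>C. T x * (1 - M x i))"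
      proof (rule prod.cong[OF refl])
        fix x assume x: "x \<in> C"
        have "T x = N n w x i + (\<Sum>j\<in>{1..q}-{i}. N n w x j)"
          unfolding T_def using i by (intro sum.remove) auto
        then show "(\<Sum>j\<in>{1..q}-{i}. N n w x j) = T x * (1 - M x i)"
          using IH(2)[OF x i] by (simp add: algebra_simps)
      qed
      finally show ?thesis
        by (simp add: P_def prod.distrib)
    qed
    have total: "(\<Sum>i\<in>{1..q}. N (Suc n) u w i) = (\<Prod>x\<in>C. T x) * (\<Sum>i\<in>{1..q}. P i)"
      unfolding sum_distrib_left by (intro sum.cong prod refl)
    have "N (Suc n) u w (\<omega> w) > 0"
      unfolding N_def using restrict_mem_branch_colorings[OF \<omega> Suc.prems] finite_branch_colorings
      by (metis card_gt_0_iff empty_iff of_nat_0_less_iff)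
    then have pos: "(\<Sum>i\<in>{1..q}. N (Suc n) u w i) > 0"
      using \<omega>w by (intro sum_pos2[of _ "\<omega> w"]) (auto simp: N_def)
    moreover have "(\<Sum>i\<in>{1..q}. P i) \<noteq> 0"
      using pos unfolding total by auto
    moreover have "message E W q \<sigma> (point_masses \<omega>) (Suc n) u w i = P i / (\<Sum>l\<in>{1..q}. P l)" for i
      using False by (simp add: P_def M_def C_def)
    ultimately show ?thesis
      using prod total by simp
  qed
qed

text \<open>At the root the exempt pair \<open>(v, v)\<close> is no edge, so branch colorings are
  all compatible colorings with a given color at \<open>v\<close>.\<close>

lemma (in locally_finite_tree) compatible_marginal_eq_message:
  fixes n :: nat
  assumes \<omega>: "\<omega> \<in> colorings V E q" and W: "\<And>w. w \<in> W \<Longrightarrow> \<omega> w = \<sigma> w"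
    and v: "v \<in> V" "v \<notin> W" and i: "i \<in> {1..q}"
  defines "K \<equiv> compatible_colorings V E q (free_region E W (Suc n) v v) \<omega>"
  shows "card {\<tau>\<in>K. \<tau> v = i} / card K = message E W q \<sigma> (point_masses \<omega>) (Suc n) v v i"
proof -
  let ?F = "free_region E W (Suc n) v v"
  have F: "?F \<subseteq> V" "v \<in> ?F"
    using free_region_subset[OF edges_subset v(1)] v(2) by (blast, simp)
  \<comment> \<open>Edges that do not meet the region are proper because \<open>\<omega>\<close>
    is.\<close>
  have col: "override_on \<omega> \<tau> ?F \<in> colorings V E q
      \<longleftrightarrow> proper_at E ?F (v, v) (override_on \<omega> \<tau> ?F)" (is "?\<rho> \<in> _ \<longleftrightarrow> _")
    if "\<tau> \<in> ?F \<rightarrow>\<^sub>E {1..q}" for \<tau>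
  proof
    assume "?\<rho> \<in> colorings V E q"
    then show "proper_at E ?F (v, v) ?\<rho>"
      by (auto simp: colorings_def proper_at_def simp del: free_region.simps)
  next
    assume R: "proper_at E ?F (v, v) ?\<rho>"
    have "?\<rho> \<in> V \<rightarrow>\<^sub>E {1..q}"
      using that F \<omega> by (auto simp: colorings_def override_on_def PiE_iff extensional_def)
    moreover have "?\<rho> x \<noteq> ?\<rho> y" if e: "(x, y) \<in> E" for x y
    proof (cases "x \<in> ?F \<or> y \<in> ?F")
      case True
      moreover have "x \<noteq> y"
        using e not_loop by auto
      ultimately show ?thesis
        using R e edge_sym[OF e] unfolding proper_at_def by (metis Pair_inject)
    next
      case False
      then show ?thesis
        using e \<omega> by (auto simp: colorings_def)
    qed
    ultimately show "?\<rho> \<in> colorings V E q"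
      by (auto simp: colorings_def)
  qed
  have N: "{\<tau>\<in>K. \<tau> v = j} = branch_colorings E W q \<omega> (Suc n) v v j" for j
    unfolding K_def compatible_colorings_def branch_colorings_def Let_def
    using col F(2) by (auto simp del: free_region.simps)
  have "K = (\<Union>j\<in>{1..q}. {\<tau>\<in>K. \<tau> v = j})"
    using F(2) by (auto simp: K_def compatible_colorings_def simp del: free_region.simps)
  also have "card \<dots> = (\<Sum>j\<in>{1..q}. card {\<tau>\<in>K. \<tau> v = j})"
    unfolding N by (intro card_UN_disjoint ballI finite_branch_colorings impI)
      (auto simp: branch_colorings_def Let_def)
  finally have "real (card K) = (\<Sum>j\<in>{1..q}. real (card (branch_colorings E W q \<omega> (Suc n) v v j)))"
    unfolding N by simp
  moreover define T where "T = (\<Sum>j\<in>{1..q}. real (card (branch_colorings E W q \<omega> (Suc n) v v j)))"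
  ultimately have K: "real (card K) = T"
    by simp
  have "T > 0" "card (branch_colorings E W q \<omega> (Suc n) v v i)
      = T * message E W q \<sigma> (point_masses \<omega>) (Suc n) v v i"
    unfolding T_def using card_branch_colorings_message[OF \<omega> W v(1), where n = "Suc n" and u = v] i
    by blast+
  then show ?thesis
    unfolding N K by (simp del: message.simps)
qed

declare message.simps(2) [simp del]

section \<open>Upper bounds on the probability of a single color\<close>

definition bounded_distribution :: "nat \<Rightarrow> real \<Rightarrow> (nat \<Rightarrow> real) \<Rightarrow> bool" where
  "bounded_distribution q m y \<longleftrightarrow> (\<forall>i\<in>{1..q}. 0 \<le> y i \<and> y i \<le> m) \<and> (\<Sum>i\<in>{1..q}. y i) = 1"

lemma bounded_distribution_mono:
  "bounded_distribution q r y \<Longrightarrow> r \<le> r' \<Longrightarrow> bounded_distribution q r' y"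
  unfolding bounded_distribution_def by (blast intro: order_trans)

lemma bounded_distribution_convex:
  assumes "bounded_distribution q r y" "bounded_distribution q r y'" "0 \<le> t" "t \<le> 1"
  shows "bounded_distribution q r (\<lambda>i. (1 - t) * y i + t * y' i)"
proof -
  have "(1 - t) * y i + t * y' i \<le> (1 - t) * r + t * r" if "i \<in> {1..q}" for i
    using assms that by (intro add_mono mult_left_mono) (auto simp: bounded_distribution_def)
  moreover have "(1 - t) * r + t * r = r"
    by (simp add: algebra_simps)
  moreover have "0 \<le> (1 - t) * y i + t * y' i" if "i \<in> {1..q}" for i
    using assms that by (auto simp: bounded_distribution_def)
  moreover have "(\<Sum>i\<in>{1..q}. (1 - t) * y i + t * y' i) = (1 - t) * 1 + t * 1"
    using assms unfolding sum.distrib sum_distrib_left[symmetric] bounded_distribution_def by simp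
  ultimately show ?thesis
    by (simp add: bounded_distribution_def)
qed

text \<open>The Weierstrass product inequality, a union bound for independent events.\<close>

lemma prod_one_minus_ge:
  fixes x :: "'a \<Rightarrow> real"
  assumes "finite J" "\<And>j. j \<in> J \<Longrightarrow> 0 \<le> x j \<and> x j \<le> 1"
  shows "1 - (\<Sum>j\<in>J. x j) \<le> (\<Prod>j\<in>J. 1 - x j)"
  using assms
proof (induction J rule: finite_induct)
  case (insert a J)
  have "0 \<le> x a" "x a \<le> 1" "0 \<le> (\<Sum>j\<in>J. x j)"
    using insert.prems by (auto intro: sum_nonneg)
  then have "1 - (x a + (\<Sum>j\<in>J. x j)) \<le> (1 - x a) * (1 - (\<Sum>j\<in>J. x j))"
    by (simp add: algebra_simps)
  also have "\<dots> \<le> (1 - x a) * (\<Prod>j\<in>J. 1 - x j)"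
    using insert \<open>x a \<le> 1\<close> by (intro mult_left_mono) auto
  finally show ?case
    using insert.hyps by simp
qed simp

text \<open>Sum the union bound over all colors: each child has total mass 1 and so removes 1 from
  \<open>q\<close>.\<close>

lemma normalizer_ge:
  assumes "finite C" and y: "\<And>x. x \<in> C \<Longrightarrow> bounded_distribution q 1 (y x)"
  shows "real q - card C \<le> (\<Sum>l\<in>{1..q}. \<Prod>x\<in>C. 1 - y x l)"
proof -
  have "real q - card C = (\<Sum>l\<in>{1..q}. 1 :: real) - (\<Sum>x\<in>C. \<Sum>l\<in>{1..q}. y x l)"
    using y by (simp add: bounded_distribution_def)
  also have "\<dots> = (\<Sum>l\<in>{1..q}. 1 - (\<Sum>x\<in>C. y x l))"
    unfolding sum_subtractf by (subst sum.swap) simp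
  also have "\<dots> \<le> (\<Sum>l\<in>{1..q}. \<Prod>x\<in>C. 1 - y x l)"
    using assms by (intro sum_mono prod_one_minus_ge) (auto simp: bounded_distribution_def)
  finally show ?thesis .
qed

lemma bounded_distribution_normalized:
  assumes "finite C" and y: "\<And>x. x \<in> C \<Longrightarrow> bounded_distribution q 1 (y x)" and "card C < q"
  shows "bounded_distribution q (1 / (real q - card C))
    (\<lambda>i. (\<Prod>x\<in>C. 1 - y x i) / (\<Sum>l\<in>{1..q}. \<Prod>x\<in>C. 1 - y x l))"
proof -
  let ?S = "\<Sum>l\<in>{1..q}. \<Prod>x\<in>C. 1 - y x l"
  have S: "real q - card C \<le> ?S" "real q - card C > 0"
    using normalizer_ge[OF assms(1,2)] assms(3) by auto
  have P: "0 \<le> (\<Prod>x\<in>C. 1 - y x i)" "(\<Prod>x\<in>C. 1 - y x i) \<le> 1" if "i \<in> {1..q}" for i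
    using y that by (auto intro!: prod_nonneg prod_le_1 simp: bounded_distribution_def)
  have "(\<Prod>x\<in>C. 1 - y x i) / ?S \<le> 1 / (real q - card C)" if "i \<in> {1..q}" for i
    using S P[OF that] by (intro frac_le) auto
  moreover have "0 \<le> (\<Prod>x\<in>C. 1 - y x i) / ?S" if "i \<in> {1..q}" for i
    using S P[OF that] by simp
  moreover have "(\<Sum>i\<in>{1..q}. (\<Prod>x\<in>C. 1 - y x i) / ?S) = 1"
    unfolding sum_divide_distrib[symmetric] using S by simp
  ultimately show ?thesis
    unfolding bounded_distribution_def by blast
qed

section \<open>Decay of the energy\<close>

text \<open>The factor of \<open>energy_contraction\<close> for \<open>b\<close> children, with
  \<open>s = q - b\<close> and \<open>m = 1 / (q - b)\<close>.\<close>

definition contraction_rate :: "nat \<Rightarrow> nat \<Rightarrow> real" where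
  "contraction_rate b q = b / (2 * (real q - b - 1))"

text \<open>The bound \<open>q \<ge> b + 2\<close> makes single masses at most 1/2 at vertices with
  \<open>b\<close> children, and keeps the normalizer positive at the root, which has
  \<open>b + 1\<close>.\<close>

locale regular_tree_message = locally_finite_tree V E
  for V :: "'v set" and E +
  fixes b q :: nat and W :: "'v set" and \<sigma> :: "'v \<Rightarrow> nat"
  assumes degree: "w \<in> V \<Longrightarrow> card (E `` {w}) = b + 1"
    and q: "q \<ge> b + 2"
    and \<sigma>: "w \<in> W \<Longrightarrow> \<sigma> w \<in> {1..q}"
begin

abbreviation "msg \<equiv> message E W q \<sigma>"

abbreviation "energy p g \<equiv> (\<Sum>i\<in>{1..q}. p i * (g i)\<^sup>2 :: real)"

definition mass_bound :: real where "mass_bound = 1 / (real q - b)"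

abbreviation "\<kappa> \<equiv> contraction_rate b q"

lemma mass_bound: "0 < mass_bound" "mass_bound \<le> 1/2"
  using q by (auto simp: mass_bound_def field_simps)

text \<open>The invariant of the recursion. Vertices of \<open>W\<close> are treated apart because
  their point masses violate the mass bound.\<close>

definition admissible :: "('v \<Rightarrow> 'v \<Rightarrow> nat \<Rightarrow> real) \<Rightarrow> bool" where
  "admissible \<beta> \<longleftrightarrow> (\<forall>(u, w)\<in>E. if w \<in> W then \<forall>i. \<beta> u w i = of_bool (i = \<sigma> w)
     else bounded_distribution q mass_bound (\<beta> u w))"

lemma admissible_fixed: "admissible \<beta> \<Longrightarrow> (u, w) \<in> E \<Longrightarrow> w \<in> W \<Longrightarrow> \<beta> u w i = of_bool (i = \<sigma> w)"
  by (auto simp: admissible_def)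

lemma admissible_free:
  "admissible \<beta> \<Longrightarrow> (u, w) \<in> E \<Longrightarrow> w \<notin> W \<Longrightarrow> bounded_distribution q mass_bound (\<beta> u w)"
  by (auto simp: admissible_def)

lemma admissible_distribution:
  assumes "admissible \<beta>" "(u, w) \<in> E"
  shows "bounded_distribution q 1 (\<beta> u w)"
proof (cases "w \<in> W")
  case True
  then show ?thesis
    using admissible_fixed[OF assms] \<sigma>[OF True] by (auto simp: bounded_distribution_def of_bool_def)
next
  case False
  then show ?thesis
    using mass_bound by (intro bounded_distribution_mono[OF admissible_free[OF assms]]) auto
qed

lemma card_children:
  assumes "(u, w) \<in> E"
  shows "card (E `` {w} - {u}) = b"
proof -
  have "w \<in> V" "u \<in> E `` {w}"
    using assms edges_subset edge_sym by auto
  then show ?thesis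
    using degree finite_neighbours by simp
qed

text \<open>One step of the recursion smooths arbitrary distributions, point masses included, enough
  for the mass bound. Interpolation therefore starts one level above a coloring.\<close>

lemma admissible_message_1:
  assumes "\<And>u w. (u, w) \<in> E \<Longrightarrow> bounded_distribution q 1 (\<beta> u w)"
  shows "admissible (msg \<beta> (Suc 0))"
proof -
  have "bounded_distribution q mass_bound (msg \<beta> (Suc 0) u w)"
    if e: "(u, w) \<in> E" and "w \<notin> W" for u w
    using bounded_distribution_normalized[of "E `` {w} - {u}" q "\<beta> w"] that assms
      finite_neighbours q card_children[OF e]
    by (simp add: mass_bound_def message.simps(2))
  then show ?thesis
    unfolding admissible_def by (auto simp: message.simps(2))
qed

lemma msg_Suc: "msg \<beta> (Suc n) = msg (msg \<beta> n) (Suc 0)"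
  using message_add[of E W q \<sigma> \<beta> "Suc 0" n] by (simp only: add_Suc add_0)

lemma admissible_message: "admissible \<beta> \<Longrightarrow> admissible (msg \<beta> n)"
proof (induction n)
  case 0
  moreover have "msg \<beta> 0 = \<beta>"
    by (simp add: fun_eq_iff)
  ultimately show ?case
    by (simp only:)
next
  case (Suc n)
  then show ?case
    unfolding msg_Suc[of \<beta> n] by (intro admissible_message_1 admissible_distribution) auto
qed

text \<open>Children in \<open>W\<close> enter only through a factor that is constant in
  \<open>t\<close>, so the derivative involves the free children alone. Keeping the number of
  children general serves the root as well as the other vertices.\<close>

lemma message_derivative:
  assumes C_def: "C = E `` {w} - {u}" and p_def: "p = (\<lambda>t. msg (Y t) (Suc 0) u w)"
    and Y: "admissible (Y t)" and fixed: "\<forall>x\<in>C \<inter> W. \<forall>i t. Y t w x i = of_bool (i = \<sigma> x)"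
    and deriv: "\<forall>x\<in>C - W. \<forall>i\<in>{1..q}. ((\<lambda>t. Y t w x i) has_real_derivative y' x i) (at t)"
    and w: "w \<notin> W" and C: "card C < q"
  shows "\<exists>g. (\<forall>i\<in>{1..q}. ((\<lambda>t. p t i) has_real_derivative p t i * g i) (at t))
      \<and> energy (p t) g \<le> energy (p t) (\<lambda>i. \<Sum>x\<in>C - W. y' x i / (1 - Y t w x i))"
    and "\<And>i. i \<in> {1..q} \<Longrightarrow>
      0 \<le> p t i \<and> p t i \<le> (\<Prod>x\<in>C - W. 1 - Y t w x i) / (real q - card C)"
    and "(\<Sum>i\<in>{1..q}. p t i) = 1"
proof -
  have finC: "finite C"
    using finite_neighbours by (simp add: C_def)
  \<comment> \<open>The factor of the fixed children: 0 if one of them has color \<open>i\<close>,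
    otherwise 1.\<close>
  define c where "c i = (\<Prod>x\<in>C \<inter> W. 1 - of_bool (i = \<sigma> x) :: real)" for i
  define Z where "Z i t = c i * (\<Prod>x\<in>C - W. 1 - Y t w x i)" for i t
  have Z: "(\<Prod>x\<in>C. 1 - Y t w x i) = Z i t" for i t
  proof -
    have "C = (C \<inter> W) \<union> (C - W)" by blast
    then have "(\<Prod>x\<in>C. 1 - Y t w x i) = (\<Prod>x\<in>C \<inter> W. 1 - Y t w x i) * (\<Prod>x\<in>C - W. 1 - Y t w x i)"
      using finC by (subst prod.union_disjoint[symmetric]) (auto simp: Int_Un_distrib)
    moreover have "(\<Prod>x\<in>C \<inter> W. 1 - Y t w x i) = c i"
      unfolding c_def by (intro prod.cong) (auto simp: fixed)
    ultimately show ?thesis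
      by (simp add: Z_def)
  qed
  have p: "p t i = Z i t / (\<Sum>l\<in>{1..q}. Z l t)" for t i
    using w by (simp add: p_def C_def[symmetric] Z message.simps(2))
  have YC: "bounded_distribution q 1 (Y t w x)" if "x \<in> C" for x
    using that admissible_distribution[OF Y] by (auto simp: C_def)
  have Ym: "0 \<le> Y t w x i" "Y t w x i \<le> mass_bound" "Y t w x i < 1" if "x \<in> C - W" "i \<in> {1..q}" for x i
    using that admissible_free[OF Y, of w x] mass_bound
    by (auto simp: C_def bounded_distribution_def intro: order_le_less_trans[of _ mass_bound])
  have S: "real q - card C \<le> (\<Sum>l\<in>{1..q}. Z l t)" "real q - card C > 0"
    using normalizer_ge[OF finC, of q "Y t w"] YC C unfolding Z by auto
  have c: "0 \<le> c i" "c i \<le> 1" for i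
    unfolding c_def by (auto intro!: prod_nonneg prod_le_1)
  have prod: "0 \<le> (\<Prod>x\<in>C - W. 1 - Y t w x i)" if "i \<in> {1..q}" for i
    using Ym(3)[OF _ that] by (intro prod_nonneg) (auto simp: less_imp_le)
  have Z0: "0 \<le> Z i t" "Z i t \<le> (\<Prod>x\<in>C - W. 1 - Y t w x i)" if "i \<in> {1..q}" for i
    unfolding Z_def using c[of i] prod[OF that] by (auto intro: mult_left_le_one_le)
  have DZ: "(Z i has_real_derivative - Z i t * (\<Sum>x\<in>C - W. y' x i / (1 - Y t w x i))) (at t)"
    if "i \<in> {1..q}" for i
  proof -
    have "((\<lambda>t. c i * (\<Prod>x\<in>C - W. 1 - Y t w x i)) has_real_derivative
        c i * (- (\<Prod>x\<in>C - W. 1 - Y t w x i) * (\<Sum>x\<in>C - W. y' x i / (1 - Y t w x i)))) (at t)"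
      using deriv that Ym(3)[OF _ that]
      by (intro DERIV_cmult has_derivative_prod_one_minus) force+
    then show ?thesis
      unfolding Z_def by (simp add: mult.assoc)
  qed
  show "\<exists>g. (\<forall>i\<in>{1..q}. ((\<lambda>t. p t i) has_real_derivative p t i * g i) (at t))
      \<and> energy (p t) g \<le> energy (p t) (\<lambda>i. \<Sum>x\<in>C - W. y' x i / (1 - Y t w x i))"
    unfolding p using S by (intro normalized_derivative Z0 DZ) auto
  show "0 \<le> p t i \<and> p t i \<le> (\<Prod>x\<in>C - W. 1 - Y t w x i) / (real q - card C)" if "i \<in> {1..q}" for i
    unfolding p using S Z0[OF that] by (auto intro: frac_le)
  show "(\<Sum>i\<in>{1..q}. p t i) = 1"
    unfolding p sum_divide_distrib[symmetric] using S by simp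
qed

section \<open>Interpolation between two boundary conditions\<close>

definition path ::
    "('v \<Rightarrow> 'v \<Rightarrow> nat \<Rightarrow> real) \<Rightarrow> ('v \<Rightarrow> 'v \<Rightarrow> nat \<Rightarrow> real) \<Rightarrow> real \<Rightarrow> 'v \<Rightarrow> 'v \<Rightarrow> nat \<Rightarrow> real" where
  "path \<beta> \<beta>' t u w i = (1 - t) * \<beta> u w i + t * \<beta>' u w i"

lemma path_fixed:
  assumes "admissible \<beta>" "admissible \<beta>'" "(u, w) \<in> E" "w \<in> W"
  shows "path \<beta> \<beta>' t u w i = of_bool (i = \<sigma> w)"
  using assms by (simp add: path_def admissible_fixed algebra_simps)

lemma admissible_path:
  assumes "admissible \<beta>" "admissible \<beta>'" "0 \<le> t" "t \<le> 1"
  shows "admissible (path \<beta> \<beta>' t)"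
  unfolding admissible_def
proof (clarify, simp only: split: if_splits, intro conjI impI allI)
  fix u w i assume e: "(u, w) \<in> E"
  show "path \<beta> \<beta>' t u w i = of_bool (i = \<sigma> w)" if "w \<in> W"
    using path_fixed[OF assms(1,2) e that] .
  have "path \<beta> \<beta>' t u w = (\<lambda>i. (1 - t) * \<beta> u w i + t * \<beta>' u w i)"
    by (simp add: path_def fun_eq_iff)
  then show "bounded_distribution q mass_bound (path \<beta> \<beta>' t u w)" if "w \<notin> W"
    using bounded_distribution_convex[OF admissible_free[OF assms(1) e that]
        admissible_free[OF assms(2) e that] assms(3,4)] by simp
qed

lemma message_path_fixed:
  assumes "admissible \<beta>" "admissible \<beta>'" "(u, w) \<in> E" "w \<in> W"
  shows "msg (path \<beta> \<beta>' t) n u w i = of_bool (i = \<sigma> w)"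
  using path_fixed[OF assms] assms by (cases n) (auto simp: message.simps(2))

text \<open>Here \<open>g\<close> is a logarithmic derivative, in a form that also makes sense for
  colors of probability 0, such as those blocked by a fixed neighbour.\<close>

definition has_energy ::
    "(real \<Rightarrow> nat \<Rightarrow> real) \<Rightarrow> real \<Rightarrow> real \<Rightarrow> bool" where
  "has_energy p t B \<longleftrightarrow> (\<exists>g. (\<forall>i\<in>{1..q}. ((\<lambda>t. p t i) has_real_derivative p t i * g i) (at t))
     \<and> energy (p t) g \<le> B)"

text \<open>On the boundary itself logarithmic derivatives may fail to exist, because probabilities
  may vanish at an end of the path only. One level higher they are controlled by a sum of at most
  \<open>b\<close> terms, each of absolute value at most 1.\<close>

lemma has_energy_base:
  assumes adm: "admissible \<beta>" "admissible \<beta>'" and t: "0 \<le> t" "t \<le> 1"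
    and e: "(u, w) \<in> E" and w: "w \<notin> W"
  shows "has_energy (\<lambda>t. msg (path \<beta> \<beta>' t) (Suc 0) u w) t ((real b)\<^sup>2)"
proof -
  define C where "C = E `` {w} - {u}"
  define y' where "y' x i = \<beta>' w x i - \<beta> w x i" for x i
  define p where "p = (\<lambda>t. msg (path \<beta> \<beta>' t) (Suc 0) u w)"
  have card: "card C = b" and finC: "finite C" and CE: "\<And>x. x \<in> C \<Longrightarrow> (w, x) \<in> E"
    using card_children[OF e] finite_neighbours by (auto simp: C_def)
  have derY: "\<forall>x\<in>C - W. \<forall>i\<in>{1..q}.
      ((\<lambda>t. path \<beta> \<beta>' t w x i) has_real_derivative y' x i) (at t)"
    unfolding path_def y'_def by (auto intro!: derivative_eq_intros)
  have fixed: "\<forall>x\<in>C \<inter> W. \<forall>i t. path \<beta> \<beta>' t w x i = of_bool (i = \<sigma> x)"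
    using path_fixed[OF adm CE] by blast
  have "card C < q"
    using card q by simp
  note der = message_derivative[OF C_def p_def admissible_path[OF adm t] fixed derY w this]
  have p0: "0 \<le> p t i" if "i \<in> {1..q}" for i
    using der(2)[OF that] by blast
  have p1: "(\<Sum>i\<in>{1..q}. p t i) = 1"
    by (rule der(3))
  obtain g where g: "\<forall>i\<in>{1..q}. ((\<lambda>t. p t i) has_real_derivative p t i * g i) (at t)"
    "energy (p t) g \<le> energy (p t) (\<lambda>i. \<Sum>x\<in>C - W. y' x i / (1 - path \<beta> \<beta>' t w x i))"
    using der(1) by blast
  have s: "\<bar>\<Sum>x\<in>C - W. y' x i / (1 - path \<beta> \<beta>' t w x i)\<bar> \<le> b" if i: "i \<in> {1..q}" for i
  proof -
    have "\<bar>y' x i / (1 - path \<beta> \<beta>' t w x i)\<bar> \<le> 1" if "x \<in> C - W" for x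
    proof -
      have "0 \<le> \<beta> w x i" "\<beta> w x i \<le> mass_bound" "0 \<le> \<beta>' w x i" "\<beta>' w x i \<le> mass_bound"
        "path \<beta> \<beta>' t w x i \<le> mass_bound"
        using adm admissible_path[OF adm t] admissible_free[OF _ CE, of _ x] that i
        by (auto simp: bounded_distribution_def)
      \<comment> \<open>Both boundary values lie between 0 and 1/2, and so does the interpolated
        one.\<close>
      then have "\<bar>y' x i\<bar> \<le> 1/2" "1 - path \<beta> \<beta>' t w x i \<ge> 1/2"
        using mass_bound unfolding y'_def abs_le_iff by linarith+
      then show ?thesis
        by (simp add: abs_divide divide_le_eq)
    qed
    then have "\<bar>\<Sum>x\<in>C - W. y' x i / (1 - path \<beta> \<beta>' t w x i)\<bar> \<le> (\<Sum>x\<in>C - W. 1)"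
      by (intro order_trans[OF sum_abs] sum_mono)
    also have "\<dots> \<le> real b"
      using card card_mono[OF finC, of "C - W"] by auto
    finally show ?thesis .
  qed
  have "energy (p t) (\<lambda>i. \<Sum>x\<in>C - W. y' x i / (1 - path \<beta> \<beta>' t w x i))
      \<le> (\<Sum>i\<in>{1..q}. p t i * (real b)\<^sup>2)"
    using s p0 by (intro sum_mono mult_left_mono) (auto simp flip: abs_le_square_iff)
  also have "\<dots> = (real b)\<^sup>2"
    unfolding sum_distrib_right[symmetric] p1 by simp
  finally have "energy (p t) g \<le> (real b)\<^sup>2"
    using g(2) by linarith
  then have "has_energy p t ((real b)\<^sup>2)"
    using g(1) unfolding has_energy_def by blast
  then show ?thesis
    by (simp only: p_def)
qed

text \<open>Insert the derivatives \<open>Y * G\<close> of the children into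
  \<open>message_derivative\<close>; the energy that results is the one estimated in
  \<open>energy_contraction\<close>.\<close>

lemma has_energy_step:
  assumes adm: "admissible \<beta>" "admissible \<beta>'" and t: "0 \<le> t" "t \<le> 1"
    and w: "w \<notin> W" and C: "card (E `` {w} - {u}) < q" and B: "0 \<le> B"
    and children: "\<And>x. (w, x) \<in> E \<Longrightarrow> x \<notin> W \<Longrightarrow> has_energy (\<lambda>t. msg (path \<beta> \<beta>' t) n w x) t B"
  shows "has_energy (\<lambda>t. msg (path \<beta> \<beta>' t) (Suc n) u w) t
    (card (E `` {w} - {u}) / (2 * (real q - card (E `` {w} - {u})) * (1 - mass_bound)) * B)"
proof -
  define C where "C = E `` {w} - {u}"
  define Y where "Y t = msg (path \<beta> \<beta>' t) n" for t
  define p where "p = (\<lambda>t. msg (Y t) (Suc 0) u w)"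
  have p_eq: "p = (\<lambda>t. msg (path \<beta> \<beta>' t) (Suc n) u w)"
    unfolding p_def Y_def msg_Suc[of _ n] ..
  have finC: "finite C" and CE: "\<And>x. x \<in> C \<Longrightarrow> (w, x) \<in> E"
    using finite_neighbours by (auto simp: C_def)
  have "\<forall>x\<in>C - W. \<exists>g. (\<forall>i\<in>{1..q}. ((\<lambda>t. Y t w x i) has_real_derivative Y t w x i * g i) (at t))
     \<and> energy (Y t w x) g \<le> B"
    using children CE unfolding has_energy_def Y_def by blast
  then obtain G where "\<forall>x\<in>C - W. (\<forall>i\<in>{1..q}.
      ((\<lambda>t. Y t w x i) has_real_derivative Y t w x i * G x i) (at t)) \<and> energy (Y t w x) (G x) \<le> B"
    by (rule bchoice[THEN exE])
  then have G: "\<forall>x\<in>C - W. \<forall>i\<in>{1..q}. ((\<lambda>t. Y t w x i) has_real_derivative Y t w x i * G x i) (at t)"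
    and GB: "\<And>x. x \<in> C - W \<Longrightarrow> energy (Y t w x) (G x) \<le> B"
    by blast+
  have admY: "admissible (Y t)"
    unfolding Y_def by (intro admissible_message admissible_path adm t)
  have fixed: "\<forall>x\<in>C \<inter> W. \<forall>i t. Y t w x i = of_bool (i = \<sigma> x)"
    unfolding Y_def using message_path_fixed[OF adm CE] by blast
  have Cq: "card C < q"
    using C by (simp add: C_def)
  note der = message_derivative[OF C_def p_def admY fixed G w Cq]
  have Y: "0 \<le> Y t w x i \<and> Y t w x i \<le> mass_bound" if "x \<in> C - W" "i \<in> {1..q}" for x i
    using that admissible_free[OF admY CE, of x] by (auto simp: bounded_distribution_def)
  obtain g where g: "\<forall>i\<in>{1..q}. ((\<lambda>t. p t i) has_real_derivative p t i * g i) (at t)"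
    "energy (p t) g \<le> energy (p t) (\<lambda>i. \<Sum>x\<in>C - W. Y t w x i * G x i / (1 - Y t w x i))"
    using der(1) by blast
  note g(2)
  also have "energy (p t) (\<lambda>i. \<Sum>x\<in>C - W. Y t w x i * G x i / (1 - Y t w x i))
      \<le> card (C - W) / (2 * (real q - card C) * (1 - mass_bound)) * B"
  proof (rule energy_contraction)
    show "finite (C - W)"
      using finC by simp
    show "0 < real q - card C"
      using Cq by simp
  qed (use Y mass_bound GB der(2) in auto)
  also have "\<dots> \<le> card C / (2 * (real q - card C) * (1 - mass_bound)) * B"
    using B Cq mass_bound card_mono[OF finC, of "C - W"]
    by (intro mult_right_mono divide_right_mono) auto
  finally have "has_energy p t (card C / (2 * (real q - card C) * (1 - mass_bound)) * B)"
    using g(1) unfolding has_energy_def by blast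
  then show ?thesis
    by (simp only: p_eq C_def)
qed

lemma \<kappa>_nonneg: "0 \<le> \<kappa>"
  using q by (simp add: contraction_rate_def)

text \<open>Of the \<open>Suc n\<close> levels the lowest gives the bound \<open>b\<close> squared
  and each of the others a factor \<open>\<kappa>\<close>.\<close>

lemma has_energy_message:
  assumes adm: "admissible \<beta>" "admissible \<beta>'" and t: "0 \<le> t" "t \<le> 1"
  shows "(u, w) \<in> E \<Longrightarrow> w \<notin> W \<Longrightarrow>
    has_energy (\<lambda>t. msg (path \<beta> \<beta>' t) (Suc n) u w) t ((real b)\<^sup>2 * \<kappa> ^ n)"
proof (induction n arbitrary: u w)
  case 0
  then show ?case
    using has_energy_base[OF assms] by simp
next
  case (Suc n)
  \<comment> \<open>With \<open>mass_bound = 1 / (q - b)\<close>, the product of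
    \<open>q - b\<close> and \<open>1 - mass_bound\<close> is \<open>q - b - 1\<close>.\<close>
  have "2 * (real q - b) * (1 - mass_bound) = 2 * (real q - b - 1)"
    using q by (simp add: mass_bound_def field_simps)
  then have "real b / (2 * (real q - b) * (1 - mass_bound)) = \<kappa>"
    by (simp add: contraction_rate_def)
  then show ?case
    using has_energy_step[OF assms Suc.prems(2) _ _ Suc.IH, of u] card_children[OF Suc.prems(1)]
      \<kappa>_nonneg q by (simp add: mult.commute mult.left_commute)
qed

text \<open>The root has one child more than the other vertices, so its step is charged a factor
  \<open>b + 1\<close> instead of \<open>\<kappa>\<close>. The energy bounds the square of the
  derivative of a single probability, and the mean value theorem in \<open>t\<close> turns this into
  a bound on the difference.\<close>

lemma root_message_difference:
  assumes adm: "admissible \<beta>" "admissible \<beta>'" and v: "v \<in> V" "v \<notin> W" and i: "i \<in> {1..q}"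
  shows "(msg \<beta>' (Suc (Suc n)) v v i - msg \<beta> (Suc (Suc n)) v v i)\<^sup>2 \<le> (b + 1) * (real b)\<^sup>2 * \<kappa> ^ n"
proof -
  let ?B = "(b + 1) * (real b)\<^sup>2 * \<kappa> ^ n"
  let ?p = "\<lambda>t. msg (path \<beta> \<beta>' t) (Suc (Suc n)) v v"
  have Cv: "E `` {v} - {v} = E `` {v}"
    using not_loop by auto
  have card: "card (E `` {v} - {v}) = b + 1"
    unfolding Cv using degree[OF v(1)] .
  have deriv: "\<exists>d. ((\<lambda>t. ?p t i) has_real_derivative d) (at t) \<and> d\<^sup>2 \<le> ?B"
    if t: "0 \<le> t" "t \<le> 1" for t
  proof -
    have qb: "real q - (b + 1) \<ge> 1"
      using q by linarith
    have "has_energy ?p t ((b + 1) / (2 * (real q - (b + 1)) * (1 - mass_bound)) * ((real b)\<^sup>2 * \<kappa> ^ n))"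
      using has_energy_step[OF adm t v(2) _ _ has_energy_message[OF adm t], of v n] q \<kappa>_nonneg
      unfolding card by simp
    then obtain g where
      g: "((\<lambda>t. ?p t i) has_real_derivative ?p t i * g i) (at t)"
      and "energy (?p t) g \<le> (b + 1) / (2 * (real q - (b + 1)) * (1 - mass_bound)) * ((real b)\<^sup>2 * \<kappa> ^ n)"
      unfolding has_energy_def using i by blast
    \<comment> \<open>From \<open>q - (b + 1) \<ge> 1\<close> and
      \<open>mass_bound \<le> 1/2\<close>.\<close>
    moreover have "1 * 1 \<le> (real q - (b + 1)) * (2 * (1 - mass_bound))"
      using qb mass_bound by (intro mult_mono) auto
    then have "1 \<le> 2 * (real q - (b + 1)) * (1 - mass_bound)"
      by (simp only: mult.assoc mult.left_commute mult_1_left)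
    then have "(b + 1) / (2 * (real q - (b + 1)) * (1 - mass_bound)) \<le> (b + 1) / 1"
      by (intro frac_le) auto
    then have "(b + 1) / (2 * (real q - (b + 1)) * (1 - mass_bound)) * ((real b)\<^sup>2 * \<kappa> ^ n)
        \<le> (b + 1) * ((real b)\<^sup>2 * \<kappa> ^ n)"
      using \<kappa>_nonneg by (intro mult_right_mono) auto
    ultimately have e: "energy (?p t) g \<le> ?B"
      unfolding mult.assoc by linarith
    have "admissible (msg (path \<beta> \<beta>' t) (Suc n))"
      by (intro admissible_message admissible_path adm t)
    then have "bounded_distribution q (1 / (real q - card (E `` {v} - {v}))) (?p t)"
      unfolding message.simps(2)[of E W q \<sigma> "path \<beta> \<beta>' t" "Suc n" v v] if_not_P[OF v(2)]
      using finite_neighbours q card by (intro bounded_distribution_normalized admissible_distribution) auto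
    then have p: "0 \<le> ?p t j" "?p t j \<le> 1" if "j \<in> {1..q}" for j
      using that qb unfolding card bounded_distribution_def
      by (auto intro: order_trans[of _ "1 / (real q - real (b + 1))"])
    have "(?p t i * g i)\<^sup>2 = ?p t i * (?p t i * (g i)\<^sup>2)"
      by (simp add: power2_eq_square)
    also have "\<dots> \<le> 1 * (?p t i * (g i)\<^sup>2)"
      using p[OF i] by (intro mult_right_mono) auto
    also have "\<dots> \<le> energy (?p t) g"
      using i p member_le_sum[of i "{1..q}" "\<lambda>i. ?p t i * (g i)\<^sup>2"] by simp
    finally show ?thesis
      using g e by (meson order_trans)
  qed
  obtain d where d: "\<And>t. 0 \<le> t \<Longrightarrow> t \<le> 1 \<Longrightarrow> ((\<lambda>t. ?p t i) has_real_derivative d t) (at t)"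
    "\<And>t. 0 \<le> t \<Longrightarrow> t \<le> 1 \<Longrightarrow> (d t)\<^sup>2 \<le> ?B"
    using deriv by metis
  obtain z where "0 < z" "z < 1" "?p 1 i - ?p 0 i = (1 - 0) * d z"
    using MVT2[of 0 1 "\<lambda>t. ?p t i" d] d(1) by auto
  moreover have "path \<beta> \<beta>' 0 = \<beta>" "path \<beta> \<beta>' 1 = \<beta>'"
    by (auto simp: path_def fun_eq_iff)
  ultimately show ?thesis
    using d(2)[of z] by simp
qed

end

section \<open>Marginals of Gibbs measures\<close>

definition compatible_marginal ::
    "'v set \<Rightarrow> ('v \<times> 'v) set \<Rightarrow> nat \<Rightarrow> 'v set \<Rightarrow> 'v \<Rightarrow> nat \<Rightarrow> ('v \<Rightarrow> nat) \<Rightarrow> real" where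
  "compatible_marginal V E q R v i \<omega> =
     card {\<tau>\<in>compatible_colorings V E q R \<omega>. \<tau> v = i} / card (compatible_colorings V E q R \<omega>)"

text \<open>The restriction of \<open>\<omega>\<close> to \<open>R\<close> is itself compatible, so
  \<open>pmf_of_set\<close> is taken over a nonempty set and is the uniform distribution.\<close>

lemma sum_pmf_compatible:
  assumes \<omega>: "\<omega> \<in> colorings V E q" and R: "finite R" "R \<subseteq> V"
  shows "(\<Sum>\<tau>\<in>{\<tau>\<in>R \<rightarrow>\<^sub>E {1..q}. \<tau> v = i}. pmf (pmf_of_set (compatible_colorings V E q R \<omega>)) \<tau>)
    = compatible_marginal V E q R v i \<omega>"
proof -
  let ?K = "compatible_colorings V E q R \<omega>" and ?T = "{\<tau>\<in>R \<rightarrow>\<^sub>E {1..q}. \<tau> v = i}"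
  have finR: "finite (R \<rightarrow>\<^sub>E {1..q})"
    using R by (intro finite_PiE) auto
  have K: "?K \<subseteq> R \<rightarrow>\<^sub>E {1..q}"
    by (auto simp: compatible_colorings_def)
  then have finK: "finite ?K"
    using finR by (rule finite_subset)
  have "override_on \<omega> (restrict \<omega> R) R = \<omega>"
    by (auto simp: override_on_def)
  then have "restrict \<omega> R \<in> ?K"
    using \<omega> R by (auto simp: compatible_colorings_def colorings_def)
  then have "pmf (pmf_of_set ?K) \<tau> = indicator ?K \<tau> / card ?K" for \<tau>
    using finK by (intro pmf_of_set) auto
  moreover have "(\<Sum>\<tau>\<in>?T. indicator ?K \<tau>) = real (card {\<tau>\<in>?K. \<tau> v = i})"
  proof -
    have "?T \<inter> ?K = {\<tau>\<in>?K. \<tau> v = i}"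
      using K by auto
    then show ?thesis
      using finR by (simp add: indicator_def sum.If_cases Int_def)
  qed
  ultimately show ?thesis
    by (simp add: compatible_marginal_def flip: sum_divide_distrib)
qed

lemma measurable_restriction_event:
  assumes \<mu>: "coloring_measure V E q \<mu>" and R: "finite R" "R \<subseteq> V" and \<tau>: "\<tau> \<in> R \<rightarrow>\<^sub>E {1..q}"
  shows "{\<omega>\<in>space \<mu>. restrict \<omega> R = \<tau>} \<in> sets \<mu>"
proof -
  have "{\<tau>} = (\<Pi>\<^sub>E x\<in>R. {\<tau> x})"
    using PiE_singleton[of \<tau> R] \<tau> by (auto simp: PiE_iff)
  also have "\<dots> \<in> sets (Pi\<^sub>M R (\<lambda>_. count_space {1..q}))"
    using R \<tau> by (intro sets_PiM_I_finite) (auto simp: PiE_iff)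
  finally have "(\<lambda>\<omega>. restrict \<omega> R) -` {\<tau>} \<inter> colorings V E q \<in> sets (color_algebra V E q R)"
    unfolding color_algebra_def by (rule in_vimage_algebra)
  then have "(\<lambda>\<omega>. restrict \<omega> R) -` {\<tau>} \<inter> colorings V E q \<in> sets \<mu>"
    using subalgebra_color_algebra[OF \<mu> R(2)] by (auto simp: subalgebra_def)
  moreover have "(\<lambda>\<omega>. restrict \<omega> R) -` {\<tau>} \<inter> colorings V E q = {\<omega>\<in>space \<mu>. restrict \<omega> R = \<tau>}"
    using \<mu> by (auto simp: coloring_measure_def)
  ultimately show ?thesis by simp
qed

lemma measurable_color_event:
  assumes \<mu>: "coloring_measure V E q \<mu>" and v: "v \<in> V"
  shows "{\<omega>\<in>space \<mu>. \<omega> v = i} \<in> sets \<mu>"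
proof -
  have "{\<omega>\<in>space \<mu>. \<omega> v = i} = (if i \<in> {1..q} then {\<omega>\<in>space \<mu>. restrict \<omega> {v} = (\<lambda>x\<in>{v}. i)} else {})"
    using \<mu> v by (auto simp: coloring_measure_def colorings_def fun_eq_iff restrict_def)
  then show ?thesis
    using measurable_restriction_event[OF \<mu>, of "{v}" "\<lambda>x\<in>{v}. i"] v by auto
qed

text \<open>Split the event by the coloring of \<open>R\<close>. Since \<open>A\<close> depends only
  on the colors outside \<open>R\<close>, each piece has the measure given by integrating its
  conditional probability over \<open>A\<close>, and these conditional probabilities add up to the
  finite marginal.\<close>

lemma measure_bounds_of_compatible_marginal:
  assumes \<mu>: "coloring_measure V E q \<mu>" and uniform: "uniform_given_outside V E q \<mu> R"
    and R: "finite R" "R \<subseteq> V" "v \<in> R" and A: "A \<in> sets (color_algebra V E q (V - R))"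
    and bounds: "AE \<omega> in \<mu>. \<omega> \<in> A \<longrightarrow>
      lo \<le> compatible_marginal V E q R v i \<omega> \<and> compatible_marginal V E q R v i \<omega> \<le> hi"
  shows "lo * measure \<mu> A \<le> measure \<mu> {\<omega>\<in>A. \<omega> v = i}"
    and "measure \<mu> {\<omega>\<in>A. \<omega> v = i} \<le> hi * measure \<mu> A"
proof -
  interpret prob_space \<mu>
    using \<mu> by (simp add: coloring_measure_def)
  let ?F = "color_algebra V E q (V - R)"
  interpret finite_measure_subalgebra \<mu> ?F
    using subalgebra_color_algebra[OF \<mu>, of "V - R"] by unfold_locales auto
  have space: "space \<mu> = colorings V E q"
    using \<mu> by (simp add: coloring_measure_def)
  have A\<mu>: "A \<in> sets \<mu>"
    using A subalg by (auto simp: subalgebra_def)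
  define T where "T = {\<tau>\<in>R \<rightarrow>\<^sub>E {1..q}. \<tau> v = i}"
  define B where "B \<tau> = {\<omega>\<in>space \<mu>. restrict \<omega> R = \<tau>}" for \<tau>
  define h where "h \<tau> = real_cond_exp \<mu> ?F (indicator (B \<tau>))" for \<tau>
  have finT: "finite T"
    using R finite_PiE[of R "\<lambda>_. {1..q}"] by (auto simp: T_def)
  have B: "B \<tau> \<in> sets \<mu>" if "\<tau> \<in> T" for \<tau>
    unfolding B_def using that by (intro measurable_restriction_event[OF \<mu> R(1,2)]) (simp add: T_def)
  have int_B: "integrable \<mu> (indicator (B \<tau>) :: _ \<Rightarrow> real)" if "\<tau> \<in> T" for \<tau>
    using B[OF that] by (simp add: integrable_indicator_iff emeasure_eq_measure)
  have int_h: "integrable \<mu> (\<lambda>\<omega>. indicator A \<omega> *\<^sub>R h \<tau> \<omega>)" if "\<tau> \<in> T" for \<tau>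
    unfolding h_def by (intro integrable_mult_indicator A\<mu> real_cond_exp_int(1) int_B that)
  have union: "{\<omega>\<in>A. \<omega> v = i} = (\<Union>\<tau>\<in>T. A \<inter> B \<tau>)"
  proof -
    have "restrict \<omega> R \<in> T" if "\<omega> \<in> A" "\<omega> v = i" for \<omega>
      using that sets.sets_into_space[OF A\<mu>] R unfolding T_def space colorings_def by auto
    then show ?thesis
      using sets.sets_into_space[OF A\<mu>] R by (auto simp: B_def T_def)
  qed
  have "measure \<mu> {\<omega>\<in>A. \<omega> v = i} = (\<Sum>\<tau>\<in>T. measure \<mu> (A \<inter> B \<tau>))"
    unfolding union
  proof (rule finite_measure_finite_Union[OF finT])
    show "(\<lambda>\<tau>. A \<inter> B \<tau>) ` T \<subseteq> sets \<mu>"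
      using A\<mu> B by auto
    show "disjoint_family_on (\<lambda>\<tau>. A \<inter> B \<tau>) T"
      by (auto simp: disjoint_family_on_def B_def)
  qed
  also have "\<dots> = (\<Sum>\<tau>\<in>T. \<integral>\<omega>. indicator A \<omega> *\<^sub>R h \<tau> \<omega> \<partial>\<mu>)"
  proof (rule sum.cong[OF refl])
    fix \<tau> assume \<tau>: "\<tau> \<in> T"
    have "measure \<mu> (A \<inter> B \<tau>) = (\<integral>\<omega>. indicator (A \<inter> B \<tau>) \<omega> \<partial>\<mu>)"
      using A\<mu> B[OF \<tau>] by simp
    also have "\<dots> = (\<integral>\<omega>\<in>A. indicator (B \<tau>) \<omega> \<partial>\<mu>)"
      unfolding set_lebesgue_integral_def by (simp add: indicator_inter_arith)
    also have "\<dots> = (\<integral>\<omega>\<in>A. h \<tau> \<omega> \<partial>\<mu>)"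
      unfolding h_def by (rule real_cond_exp_intA[OF int_B[OF \<tau>] A])
    finally show "measure \<mu> (A \<inter> B \<tau>) = (\<integral>\<omega>. indicator A \<omega> *\<^sub>R h \<tau> \<omega> \<partial>\<mu>)"
      unfolding set_lebesgue_integral_def .
  qed
  also have "\<dots> = (\<integral>\<omega>. (\<Sum>\<tau>\<in>T. indicator A \<omega> *\<^sub>R h \<tau> \<omega>) \<partial>\<mu>)"
    by (rule Bochner_Integration.integral_sum[symmetric], rule int_h)
  finally have eq: "measure \<mu> {\<omega>\<in>A. \<omega> v = i} = (\<integral>\<omega>. (\<Sum>\<tau>\<in>T. indicator A \<omega> *\<^sub>R h \<tau> \<omega>) \<partial>\<mu>)" .
  have int: "integrable \<mu> (\<lambda>\<omega>. \<Sum>\<tau>\<in>T. indicator A \<omega> *\<^sub>R h \<tau> \<omega>)"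
    by (intro Bochner_Integration.integrable_sum int_h)
  \<comment> \<open>Uniformity holds almost everywhere for each \<open>\<tau>\<close>; finiteness of
    \<open>T\<close> merges the exceptional sets.\<close>
  have "AE \<omega> in \<mu>. \<forall>\<tau>\<in>T. h \<tau> \<omega> = pmf (pmf_of_set (compatible_colorings V E q R \<omega>)) \<tau>"
    using uniform finT unfolding uniform_given_outside_def h_def B_def
    by (intro AE_finite_allI) (auto simp: T_def)
  then have AE: "AE \<omega> in \<mu>. lo * indicator A \<omega> \<le> (\<Sum>\<tau>\<in>T. indicator A \<omega> *\<^sub>R h \<tau> \<omega>)
      \<and> (\<Sum>\<tau>\<in>T. indicator A \<omega> *\<^sub>R h \<tau> \<omega>) \<le> hi * indicator A \<omega>"
    using bounds
  proof eventually_elim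
    case (elim \<omega>)
    show ?case
    proof (cases "\<omega> \<in> A")
      case True
      then have "\<omega> \<in> colorings V E q"
        using sets.sets_into_space[OF A\<mu>] space by auto
      then have "(\<Sum>\<tau>\<in>T. h \<tau> \<omega>) = compatible_marginal V E q R v i \<omega>"
        using elim(1) sum_pmf_compatible[of \<omega> V E q R v i] R by (simp add: T_def)
      then show ?thesis
        using True elim(2) by simp
    qed simp
  qed
  have int_lo: "integrable \<mu> (\<lambda>\<omega>. c * indicator A \<omega> :: real)" for c
    using A\<mu> by (simp add: integrable_indicator_iff emeasure_eq_measure)
  have "(\<integral>\<omega>. c * indicator A \<omega> \<partial>\<mu>) = c * measure \<mu> A" for c :: real
    using A\<mu> by simp
  then show "lo * measure \<mu> A \<le> measure \<mu> {\<omega>\<in>A. \<omega> v = i}"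
    and "measure \<mu> {\<omega>\<in>A. \<omega> v = i} \<le> hi * measure \<mu> A"
    using integral_mono_AE[OF int_lo int, of lo] integral_mono_AE[OF int int_lo, of hi] AE
    unfolding eq by (auto simp: sets.Int_space_eq2[OF A\<mu>])
qed

text \<open>The set \<open>U\<close> may be infinite; countability presents the event as a countable
  intersection of events about single vertices.\<close>

lemma agreeing_in_color_algebra:
  assumes p: "coloring_measure V E q p" and U: "countable U" "U \<subseteq> W" "W \<subseteq> V"
    and \<sigma>: "\<And>u. u \<in> U \<Longrightarrow> \<sigma> u \<in> {1..q}"
  shows "agreeing p U \<sigma> \<in> sets (color_algebra V E q W)"
proof -
  let ?P = "Pi\<^sub>M W (\<lambda>_. count_space {1..q})"
  have "{g \<in> space ?P. \<forall>u\<in>U. g u = \<sigma> u} \<in> sets ?P"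
  proof (intro sets.sets_Collect_countable_All' U(1))
    fix u assume u: "u \<in> U"
    have "(\<lambda>g. g u) -` {\<sigma> u} \<inter> space ?P \<in> sets ?P"
      using u U \<sigma>[OF u] by (intro measurable_sets[OF measurable_component_singleton]) auto
    moreover have "(\<lambda>g. g u) -` {\<sigma> u} \<inter> space ?P = {g \<in> space ?P. g u = \<sigma> u}"
      by auto
    ultimately show "{g \<in> space ?P. g u = \<sigma> u} \<in> sets ?P" by simp
  qed
  then have "(\<lambda>\<omega>. restrict \<omega> W) -` {g \<in> space ?P. \<forall>u\<in>U. g u = \<sigma> u} \<inter> colorings V E q
      \<in> sets (color_algebra V E q W)"
    unfolding color_algebra_def by (rule in_vimage_algebra)
  moreover have "(\<lambda>\<omega>. restrict \<omega> W) -` {g \<in> space ?P. \<forall>u\<in>U. g u = \<sigma> u} \<inter> colorings V E q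
      = agreeing p U \<sigma>"
    using p U unfolding agreeing_def by (fastforce simp: coloring_measure_def colorings_def space_PiM)
  ultimately show ?thesis by simp
qed

text \<open>An infinite-volume marginal is an average of finite ones. If the condition has positive
  probability, average under \<open>p\<close> over the agreeing event, which is determined outside
  \<open>R\<close> because \<open>R\<close> avoids \<open>U\<close>. Otherwise average under
  \<open>\<nu>\<close> over the whole space.\<close>

lemma color_marginal_bounds:
  assumes gibbs: "gibbs_measure V E q p" and cond: "conditioned_measure V E q p U \<sigma> \<nu>"
    and V: "countable V" and U: "U \<subseteq> V" and \<sigma>: "\<And>u. u \<in> U \<Longrightarrow> \<sigma> u \<in> {1..q}"
    and R: "finite R" "R \<subseteq> V - U" "v \<in> R"
    and bounds: "\<forall>\<omega>\<in>colorings V E q. (\<forall>u\<in>U. \<omega> u = \<sigma> u) \<longrightarrow>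
      lo \<le> compatible_marginal V E q R v i \<omega> \<and> compatible_marginal V E q R v i \<omega> \<le> hi"
  shows "lo \<le> color_marginal \<nu> v i \<and> color_marginal \<nu> v i \<le> hi"
proof -
  have p: "coloring_measure V E q p" and RV: "R \<subseteq> V"
    using gibbs R by (auto simp: gibbs_measure_def)
  interpret p: prob_space p
    using p by (simp add: coloring_measure_def)
  let ?A = "agreeing p U \<sigma>"
  show ?thesis
  proof (cases "measure p ?A > 0")
    case True
    then have \<nu>: "\<nu> = uniform_measure p ?A"
      using cond by (simp add: conditioned_measure_def)
    have A: "?A \<in> sets (color_algebra V E q (V - R))"
      using U R countable_subset[OF U V] \<sigma> by (intro agreeing_in_color_algebra[OF p]) auto
    have "AE \<omega> in p. \<omega> \<in> ?A \<longrightarrow>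
        lo \<le> compatible_marginal V E q R v i \<omega> \<and> compatible_marginal V E q R v i \<omega> \<le> hi"
      using p bounds by (intro AE_I2 impI) (auto simp: agreeing_def coloring_measure_def)
    moreover have "uniform_given_outside V E q p R"
      using gibbs R RV by (simp add: gibbs_measure_def)
    ultimately have le: "lo * measure p ?A \<le> measure p {\<omega>\<in>?A. \<omega> v = i}"
        "measure p {\<omega>\<in>?A. \<omega> v = i} \<le> hi * measure p ?A"
      using measure_bounds_of_compatible_marginal[OF p _ R(1) RV R(3) A] by blast+
    have "emeasure p ?A \<noteq> 0" "emeasure p ?A \<noteq> \<infinity>"
      using True by (auto simp: p.emeasure_eq_measure)
    then have "color_marginal \<nu> v i = measure p (?A \<inter> {\<omega>\<in>space p. \<omega> v = i}) / measure p ?A"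
      unfolding color_marginal_def \<nu>
      using measurable_color_event[OF p, of v i] R RV by (auto intro!: measure_uniform_measure)
    also have "?A \<inter> {\<omega>\<in>space p. \<omega> v = i} = {\<omega>\<in>?A. \<omega> v = i}"
      by (auto simp: agreeing_def)
    finally show ?thesis
      using le True by (simp add: le_divide_eq divide_le_eq)
  next
    case False
    then have \<nu>: "coloring_measure V E q \<nu>" and AE: "AE \<omega> in \<nu>. \<forall>u\<in>U. \<omega> u = \<sigma> u"
      and uniform: "uniform_given_outside V E q \<nu> R"
      using cond R by (auto simp: conditioned_measure_def)
    interpret \<nu>: prob_space \<nu>
      using \<nu> by (simp add: coloring_measure_def)
    have space: "space \<nu> = colorings V E q"
      using \<nu> by (simp add: coloring_measure_def)
    have "space \<nu> \<in> sets (color_algebra V E q (V - R))"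
      using sets.top[of "color_algebra V E q (V - R)"] by (simp add: color_algebra_def space)
    moreover have "AE \<omega> in \<nu>. \<omega> \<in> space \<nu> \<longrightarrow>
        lo \<le> compatible_marginal V E q R v i \<omega> \<and> compatible_marginal V E q R v i \<omega> \<le> hi"
      using AE by eventually_elim (use bounds space in auto)
    ultimately show ?thesis
      using measure_bounds_of_compatible_marginal[OF \<nu> uniform R(1) RV R(3), of "space \<nu>" lo i hi]
      by (simp add: color_marginal_def \<nu>.prob_space)
  qed
qed

text \<open>By connectedness the vertices are exhausted by the finite sets reached in
  \<open>n\<close> steps from one vertex.\<close>

lemma (in locally_finite_tree) countable_vertices: "countable V"
proof -
  obtain v where v: "v \<in> V" "\<And>u. u \<in> V \<Longrightarrow> (v, u) \<in> E\<^sup>*"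
    using tree by (auto simp: is_tree_def graph_connected_def)
  have "finite ((E ^^ n) `` {v})" for n
  proof (induction n)
    case (Suc n)
    have "(E ^^ Suc n) `` {v} = (\<Union>u\<in>(E ^^ n) `` {v}. E `` {u})"
      by auto
    then show ?case
      using Suc finite_neighbours by simp
  qed simp
  moreover have "V \<subseteq> (\<Union>n. (E ^^ n) `` {v})"
    using v by (auto simp: rtrancl_power)
  ultimately show ?thesis
    by (meson countable_UN countable_finite countable_subset uncountable_def countableI_type)
qed

section \<open>Comparison of the marginals for two boundary colorings\<close>

lemma relpow_graph_dist_le: "(v, u) \<in> E ^^ n \<Longrightarrow> graph_dist E v u \<le> n"
  unfolding graph_dist_def by (rule Least_le)

lemma cayley_tree_locally_finite:
  assumes "cayley_tree b V E"
  shows "locally_finite_tree V E"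
proof
  show "is_tree V E"
    using assms by (simp add: cayley_tree_def)
  have "E `` {w} = {}" if "w \<notin> V" for w
    using assms that by (auto simp: cayley_tree_def is_tree_def simple_graph_def)
  moreover have "finite (E `` {w})" if "w \<in> V" for w
    using assms that by (simp add: cayley_tree_def Image_singleton)
  ultimately show "finite (E `` {w})" for w
    by (cases "w \<in> V") auto
qed

text \<open>The region is cut off at the vertices of \<open>U\<close> where \<open>\<sigma>\<close>
  and \<open>\<phi>\<close> agree, and at a depth that the disagreements lie beyond. Both conditions
  then yield the same recursion and differ only in the messages at the bottom. The finite bound
  passes to the averages.\<close>

lemma marginal_difference_bound:
  assumes tree: "cayley_tree b V E" and q: "q \<ge> b + 2"
    and gibbs: "gibbs_measure V E q p" and U: "U \<subseteq> V" and v: "v \<in> V - U"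
    and \<sigma>: "\<sigma> \<in> colorings V E q" and \<phi>: "\<phi> \<in> colorings V E q"
    and \<nu>: "conditioned_measure V E q p U \<sigma> \<nu>" and \<nu>': "conditioned_measure V E q p U \<phi> \<nu>'"
    and dist: "Suc (Suc (Suc n)) \<le> graph_set_dist E v {u\<in>U. \<sigma> u \<noteq> \<phi> u}"
    and i: "i \<in> {1..q}"
  shows "(color_marginal \<nu> v i - color_marginal \<nu>' v i)\<^sup>2 \<le> (real b + 1) * (real b)\<^sup>2 * contraction_rate b q ^ n"
proof -
  define W where "W = {u\<in>U. \<sigma> u = \<phi> u}"
  \<comment> \<open>Three extra levels: one makes the boundary coloring admissible, one gives the
    initial energy bound, and one is the root.\<close>
  define d where "d = Suc (Suc (Suc n))"
  define R where "R = free_region E W d v v"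
  interpret locally_finite_tree V E
    using cayley_tree_locally_finite[OF tree] .
  have \<sigma>q: "\<sigma> u \<in> {1..q}" and \<phi>q: "\<phi> u \<in> {1..q}" if "u \<in> V" for u
    using \<sigma> \<phi> that by (auto simp: colorings_def)
  have degree: "card (E `` {w}) = b + 1" if "w \<in> V" for w
    using assms(1) that unfolding cayley_tree_def Image_singleton by blast
  interpret regular_tree_message V E b q W \<sigma>
  proof
    show "card (E `` {w}) = b + 1" if "w \<in> V" for w
      using degree[OF that] .
    show "\<sigma> w \<in> {1..q}" if "w \<in> W" for w
      using that U \<sigma>q[of w] unfolding W_def by blast
  qed (rule q)
  have vV: "v \<in> V" "v \<notin> W"
    using v by (auto simp: W_def)
  \<comment> \<open>Agreeing vertices stop the recursion and disagreeing ones are too far away, so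
    \<open>R\<close> is free of conditioned vertices.\<close>
  have "a \<notin> U" if a: "a \<in> R" for a
  proof
    assume "a \<in> U"
    moreover have "a \<notin> W"
      using free_region_disjoint that unfolding R_def by metis
    ultimately have "a \<in> {u\<in>U. \<sigma> u \<noteq> \<phi> u}"
      by (auto simp: W_def)
    then have "graph_set_dist E v {u\<in>U. \<sigma> u \<noteq> \<phi> u} \<le> graph_dist E v a"
      unfolding graph_set_dist_def by (intro cINF_lower) auto
    moreover obtain m where "m < d" "(v, a) \<in> E ^^ m"
      using free_region_relpow[OF a[unfolded R_def]] by blast
    ultimately show False
      using dist relpow_graph_dist_le[of v a m E] by (simp add: d_def)
  qed
  moreover have "R \<subseteq> V"
    unfolding R_def by (rule free_region_subset[OF edges_subset vV(1)])
  moreover have "v \<in> R"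
    using vV(2) by (simp add: R_def d_def)
  moreover have "finite R"
    unfolding R_def by (rule finite_free_region[OF finite_neighbours])
  ultimately have R: "finite R" "R \<subseteq> V - U" "v \<in> R"
    by auto
  have marginal: "compatible_marginal V E q R v i \<omega> = msg (msg (point_masses \<omega>) (Suc 0)) (Suc (Suc n)) v v i"
    and admissible: "admissible (msg (point_masses \<omega>) (Suc 0))"
    if \<omega>: "\<omega> \<in> colorings V E q" "\<And>u. u \<in> W \<Longrightarrow> \<omega> u = \<sigma> u" for \<omega>
  proof -
    show "compatible_marginal V E q R v i \<omega> = msg (msg (point_masses \<omega>) (Suc 0)) (Suc (Suc n)) v v i"
      using compatible_marginal_eq_message[OF \<omega> vV i, of "Suc (Suc n)"]
        message_add[of E W q \<sigma> "point_masses \<omega>" "Suc (Suc n)" "Suc 0"]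
      by (simp add: compatible_marginal_def R_def d_def del: free_region.simps)
    have "bounded_distribution q 1 (point_masses \<omega> u w)" if "(u, w) \<in> E" for u w
    proof -
      have "\<omega> w \<in> {1..q}"
        using \<omega>(1) that edges_subset by (auto simp: colorings_def)
      then show ?thesis
        by (auto simp: bounded_distribution_def point_masses_def of_bool_def)
    qed
    then show "admissible (msg (point_masses \<omega>) (Suc 0))"
      by (rule admissible_message_1)
  qed
  define D where "D = sqrt ((real b + 1) * (real b)\<^sup>2 * contraction_rate b q ^ n)"
  have close: "\<bar>compatible_marginal V E q R v i \<omega> - compatible_marginal V E q R v i \<omega>'\<bar> \<le> D"
    if "\<omega> \<in> colorings V E q" "\<And>u. u \<in> U \<Longrightarrow> \<omega> u = \<sigma> u"
      and "\<omega>' \<in> colorings V E q" "\<And>u. u \<in> U \<Longrightarrow> \<omega>' u = \<phi> u" for \<omega> \<omega>'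
  proof -
    have "\<omega> u = \<sigma> u" "\<omega>' u = \<sigma> u" if "u \<in> W" for u
      using that \<open>\<And>u. u \<in> U \<Longrightarrow> \<omega> u = \<sigma> u\<close> \<open>\<And>u. u \<in> U \<Longrightarrow> \<omega>' u = \<phi> u\<close> by (auto simp: W_def)
    then have "(compatible_marginal V E q R v i \<omega> - compatible_marginal V E q R v i \<omega>')\<^sup>2
        \<le> (real b + 1) * (real b)\<^sup>2 * contraction_rate b q ^ n"
      using root_message_difference[OF admissible admissible vV i, of \<omega>' \<omega> n] marginal that(1,3)
      by (simp add: add.commute)
    then show ?thesis
      unfolding D_def by (rule real_le_rsqrt[of "\<bar>_\<bar>", simplified])
  qed
  have \<sigma>U: "\<And>u. u \<in> U \<Longrightarrow> \<sigma> u \<in> {1..q}" and \<phi>U: "\<And>u. u \<in> U \<Longrightarrow> \<phi> u \<in> {1..q}"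
    using U \<sigma>q \<phi>q by auto
  \<comment> \<open>The averages are taken one after the other: first over \<open>\<omega>\<close>
    with \<open>\<omega>'\<close> held fixed, then over \<open>\<omega>'\<close>.\<close>
  have "color_marginal \<nu> v i - D \<le> compatible_marginal V E q R v i \<omega>'
      \<and> compatible_marginal V E q R v i \<omega>' \<le> color_marginal \<nu> v i + D"
    if \<omega>': "\<omega>' \<in> colorings V E q" "\<And>u. u \<in> U \<Longrightarrow> \<omega>' u = \<phi> u" for \<omega>'
  proof -
    have "compatible_marginal V E q R v i \<omega>' - D \<le> compatible_marginal V E q R v i \<omega>
      \<and> compatible_marginal V E q R v i \<omega> \<le> compatible_marginal V E q R v i \<omega>' + D"
      if "\<omega> \<in> colorings V E q" "\<And>u. u \<in> U \<Longrightarrow> \<omega> u = \<sigma> u" for \<omega>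
      using close[OF that \<omega>'] by linarith
    then have "compatible_marginal V E q R v i \<omega>' - D \<le> color_marginal \<nu> v i
      \<and> color_marginal \<nu> v i \<le> compatible_marginal V E q R v i \<omega>' + D"
      by (intro color_marginal_bounds[OF gibbs \<nu> countable_vertices U \<sigma>U R] ballI impI) blast+
    then show ?thesis by linarith
  qed
  then have "color_marginal \<nu> v i - D \<le> color_marginal \<nu>' v i
      \<and> color_marginal \<nu>' v i \<le> color_marginal \<nu> v i + D"
    by (intro color_marginal_bounds[OF gibbs \<nu>' countable_vertices U \<phi>U R] ballI impI) blast+
  then have "\<bar>color_marginal \<nu> v i - color_marginal \<nu>' v i\<bar> \<le> D" by linarith
  then have "(color_marginal \<nu> v i - color_marginal \<nu>' v i)\<^sup>2 \<le> D\<^sup>2"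
    using abs_le_square_iff by (metis abs_of_nonneg abs_ge_zero order_trans)
  then show ?thesis
    using \<kappa>_nonneg by (simp add: D_def)
qed

lemma compatible_marginal_range:
  assumes "finite R"
  shows "0 \<le> compatible_marginal V E q R v i \<omega>" "compatible_marginal V E q R v i \<omega> \<le> 1"
proof -
  have "finite (R \<rightarrow>\<^sub>E {1..q})"
    using assms by (intro finite_PiE) auto
  then have "finite (compatible_colorings V E q R \<omega>)"
    by (rule finite_subset[rotated]) (auto simp: compatible_colorings_def)
  then have "card {\<tau>\<in>compatible_colorings V E q R \<omega>. \<tau> v = i} \<le> card (compatible_colorings V E q R \<omega>)"
    by (intro card_mono) auto
  then show "0 \<le> compatible_marginal V E q R v i \<omega>" "compatible_marginal V E q R v i \<omega> \<le> 1"
    by (auto simp: compatible_marginal_def divide_le_eq_1)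
qed

text \<open>Dividing by the third power of the rate absorbs the three extra levels. At distance
  below 3 the right side is at least 1, and the claim only says that probabilities lie between 0 and
  1.\<close>

lemma marginal_difference_decay:
  assumes tree: "cayley_tree b V E" and q: "q \<ge> b + 2" and b: "b \<ge> 1" and \<kappa>: "contraction_rate b q < 1"
    and gibbs: "gibbs_measure V E q p" and U: "U \<subseteq> V" and v: "v \<in> V - U"
    and \<sigma>: "\<sigma> \<in> colorings V E q" and \<phi>: "\<phi> \<in> colorings V E q"
    and \<nu>: "conditioned_measure V E q p U \<sigma> \<nu>" and \<nu>': "conditioned_measure V E q p U \<phi> \<nu>'"
    and i: "i \<in> {1..q}"
  defines "d \<equiv> graph_set_dist E v {u\<in>U. \<sigma> u \<noteq> \<phi> u}"
  shows "(color_marginal \<nu> v i - color_marginal \<nu>' v i)\<^sup>2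
    \<le> (real b + 1) * (real b)\<^sup>2 * contraction_rate b q ^ d / contraction_rate b q ^ 3"
proof -
  let ?\<kappa> = "contraction_rate b q"
  have \<kappa>0: "0 < ?\<kappa>"
    using b q by (simp add: contraction_rate_def)
  show ?thesis
  proof (cases "d < 3")
    case True
    interpret locally_finite_tree V E
      using cayley_tree_locally_finite[OF tree] .
    have "0 \<le> color_marginal \<nu> v i \<and> color_marginal \<nu> v i \<le> 1"
      using U v \<sigma> compatible_marginal_range[of "{v}" V E q v i]
      by (intro color_marginal_bounds[OF gibbs \<nu> countable_vertices, of "{v}"]) (auto simp: colorings_def)
    moreover have "0 \<le> color_marginal \<nu>' v i \<and> color_marginal \<nu>' v i \<le> 1"
      using U v \<phi> compatible_marginal_range[of "{v}" V E q v i]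
      by (intro color_marginal_bounds[OF gibbs \<nu>' countable_vertices, of "{v}"]) (auto simp: colorings_def)
    ultimately have "\<bar>color_marginal \<nu> v i - color_marginal \<nu>' v i\<bar> \<le> 1"
      by linarith
    then have le1: "(color_marginal \<nu> v i - color_marginal \<nu>' v i)\<^sup>2 \<le> 1"
      by (simp add: abs_square_le_1)
    have "?\<kappa> ^ 3 \<le> ?\<kappa> ^ d"
      using True \<kappa> \<kappa>0 by (intro power_decreasing) auto
    moreover have "1 * 1 \<le> (real b + 1) * (real b)\<^sup>2"
      using b by (intro mult_mono) auto
    ultimately have "1 * ?\<kappa> ^ 3 \<le> (real b + 1) * (real b)\<^sup>2 * ?\<kappa> ^ d"
      using \<kappa>0 by (intro mult_mono) (auto simp: add.commute)
    then have "1 \<le> (real b + 1) * (real b)\<^sup>2 * ?\<kappa> ^ d / ?\<kappa> ^ 3"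
      using \<kappa>0 by (simp add: le_divide_eq)
    then show ?thesis
      using le1 by linarith
  next
    case False
    define n where "n = d - 3"
    have n: "d = Suc (Suc (Suc n))"
      using False by (simp add: n_def)
    then have "?\<kappa> ^ d / ?\<kappa> ^ 3 = ?\<kappa> ^ n"
      using \<kappa>0 by (simp add: power3_eq_cube)
    then show ?thesis
      using marginal_difference_bound[OF tree q gibbs U v \<sigma> \<phi> \<nu> \<nu>' _ i, of n] n
      by (simp add: d_def flip: times_divide_eq_right)
  qed
qed

section \<open>Passage to an arbitrary norm and choice of the constants\<close>

lemma vector_norm_le:
  assumes N: "vector_norm q N" and x: "x \<in> real_vectors q"
  shows "N x \<le> (\<Sum>i\<in>{1..q}. \<bar>x i\<bar> * N (\<lambda>j. of_bool (j = i)))"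
proof -
  have N0: "N (\<lambda>_. 0) = 0"
    using N by (auto simp: vector_norm_def real_vectors_def)
  \<comment> \<open>Expansion in the standard basis, one coordinate at a time by the triangle
    inequality. All vectors involved must be shown to lie in \<open>real_vectors q\<close>, where
    alone \<open>N\<close> is constrained.\<close>
  have "N (\<lambda>j. of_bool (j \<in> S) * x j) \<le> (\<Sum>i\<in>S. \<bar>x i\<bar> * N (\<lambda>j. of_bool (j = i)))"
    if "finite S" "S \<subseteq> {1..q}" for S
    using that
  proof (induction S rule: finite_induct)
    case (insert a S)
    have e: "(\<lambda>j. of_bool (j = a)) \<in> real_vectors q"
      using insert.prems by (auto simp: real_vectors_def)
    have xS: "(\<lambda>j. of_bool (j \<in> S) * x j) \<in> real_vectors q"
      using x by (auto simp: real_vectors_def)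
    have xe: "(\<lambda>j. x a * of_bool (j = a)) \<in> real_vectors q"
      using e by (auto simp: real_vectors_def)
    have "(\<lambda>j. of_bool (j \<in> insert a S) * x j) = (\<lambda>j. x a * of_bool (j = a) + of_bool (j \<in> S) * x j)"
      using insert.hyps by (auto simp: fun_eq_iff)
    then have "N (\<lambda>j. of_bool (j \<in> insert a S) * x j)
        \<le> N (\<lambda>j. x a * of_bool (j = a)) + N (\<lambda>j. of_bool (j \<in> S) * x j)"
      using N xe xS unfolding vector_norm_def by auto
    also have "N (\<lambda>j. x a * of_bool (j = a)) = \<bar>x a\<bar> * N (\<lambda>j. of_bool (j = a))"
    proof -
      have "\<forall>y\<in>real_vectors q. N (\<lambda>j. x a * y j) = \<bar>x a\<bar> * N y"
        using N unfolding vector_norm_def by blast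
      from bspec[OF this e] show ?thesis .
    qed
    finally show ?case
      using insert by simp
  qed (simp add: N0)
  from this[of "{1..q}"] have "N (\<lambda>j. of_bool (j \<in> {1..q}) * x j)
      \<le> (\<Sum>i\<in>{1..q}. \<bar>x i\<bar> * N (\<lambda>j. of_bool (j = i)))"
    by blast
  moreover have "(\<lambda>j. of_bool (j \<in> {1..q}) * x j) = x"
    using x by (auto simp: real_vectors_def fun_eq_iff)
  ultimately show ?thesis by simp
qed

theorem theorem1:
  fixes b q :: nat and c :: real
  assumes "b \<ge> 1"
    and "c > 0" and "c = exp (1 / c)"
    and "int q \<ge> 1 + \<lceil>c * real b\<rceil>"
  shows "\<exists>a>0. \<forall>N. vector_norm q N \<longrightarrow>
    (\<exists>C>0. \<forall>(V :: 'v set) E p. cayley_tree b V E \<and> gibbs_measure V E q p \<longrightarrow>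
      strong_spatial_mixing N V E q p (\<lambda>d. C * exp (- a * real d)))"
proof -
  \<comment> \<open>Otherwise \<open>c = exp (1 / c) \<ge> 1 + 1 / c \<ge> 5/3\<close>, a
    contradiction.\<close>
  have "c > 3/2"
  proof (rule ccontr)
    assume "\<not> c > 3/2"
    then have "2/3 \<le> 1 / c"
      using \<open>c > 0\<close> by (simp add: field_simps)
    then show False
      using exp_ge_add_one_self[of "1 / c"] \<open>c = exp (1 / c)\<close> \<open>\<not> c > 3/2\<close> by linarith
  qed
  then have "3/2 * real b < c * real b"
    using \<open>b \<ge> 1\<close> by simp
  moreover have "c * real b \<le> real q - 1"
    using assms(4) by linarith
  \<comment> \<open>This inequality is equivalent to \<open>b < 2 * (q - b - 1)\<close>, that is, to
    a contraction rate below 1.\<close>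
  ultimately have qb: "real q - 1 > 3/2 * real b" by linarith
  then have q: "q \<ge> b + 2" by linarith
  define \<kappa> where "\<kappa> = contraction_rate b q"
  have \<kappa>: "0 < \<kappa>" "\<kappa> < 1"
    using qb \<open>b \<ge> 1\<close> by (auto simp: \<kappa>_def contraction_rate_def divide_less_eq)
  \<comment> \<open>Half the exponent of \<open>\<kappa>\<close>, because the energy method bounds
    squared differences.\<close>
  define a where "a = - ln \<kappa> / 2"
  have a: "a > 0"
    using \<kappa> by (simp add: a_def)
  have sqrt_pow: "sqrt (\<kappa> ^ d) = exp (- a * real d)" for d
  proof -
    have "exp (- a * real d) ^ 2 = exp (real d * ln \<kappa>)"
      by (simp add: a_def flip: exp_double)
    also have "\<dots> = \<kappa> ^ d"
      using \<kappa> by (simp add: exp_of_nat_mult)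
    finally show ?thesis
      by (intro real_sqrt_unique) auto
  qed
  define K where "K = sqrt ((real b + 1) * (real b)\<^sup>2 / \<kappa> ^ 3)"
  have K: "K \<ge> 0"
    using \<kappa> by (simp add: K_def)
  show ?thesis
  proof (rule exI[of _ a], intro conjI a allI impI)
    fix N assume N: "vector_norm q N"
    define L where "L = (\<Sum>i\<in>{1..q}. N (\<lambda>j. of_bool (j = i)))"
    have Ne: "N (\<lambda>j. of_bool (j = i)) \<ge> 0" if "i \<in> {1..q}" for i
    proof -
      have "(\<lambda>j. of_bool (j = i)) \<in> real_vectors q"
        using that by (auto simp: real_vectors_def)
      then show ?thesis
        using N unfolding vector_norm_def by blast
    qed
    then have L: "L \<ge> 0"
      unfolding L_def by (rule sum_nonneg)
    show "\<exists>C>0. \<forall>(V :: 'v set) E p. cayley_tree b V E \<and> gibbs_measure V E q p \<longrightarrow>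
      strong_spatial_mixing N V E q p (\<lambda>d. C * exp (- a * real d))"
    \<comment> \<open>Adding 1 makes the constant positive when only \<open>K \<ge> 0\<close> and
      \<open>L \<ge> 0\<close> are at hand.\<close>
    proof (rule exI[of _ "K * L + 1"], intro conjI allI impI)
      show "K * L + 1 > 0"
        using K L by (simp add: add_nonneg_pos)
      fix V :: "'v set" and E p
      assume "cayley_tree b V E \<and> gibbs_measure V E q p"
      then have tree: "cayley_tree b V E" and gibbs: "gibbs_measure V E q p" by auto
      show "strong_spatial_mixing N V E q p (\<lambda>d. (K * L + 1) * exp (- a * real d))"
        unfolding strong_spatial_mixing_def
      proof (intro allI impI, elim conjE)
        fix U v \<sigma> \<phi> \<nu> \<nu>'
        assume U: "U \<subseteq> V" "v \<in> V - U" and col: "\<sigma> \<in> colorings V E q" "\<phi> \<in> colorings V E q"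
          and \<nu>: "conditioned_measure V E q p U \<sigma> \<nu>" "conditioned_measure V E q p U \<phi> \<nu>'"
        let ?d = "graph_set_dist E v {u\<in>U. \<sigma> u \<noteq> \<phi> u}"
        let ?x = "\<lambda>i. color_marginal \<nu> v i - color_marginal \<nu>' v i"
        have "\<bar>?x i\<bar> \<le> K * exp (- a * real ?d)" if "i \<in> {1..q}" for i
        proof -
          have "(?x i)\<^sup>2 \<le> (real b + 1) * (real b)\<^sup>2 / \<kappa> ^ 3 * \<kappa> ^ ?d"
            using marginal_difference_decay[OF tree q \<open>b \<ge> 1\<close> _ gibbs U col \<nu> that] \<kappa>(2)
            by (simp add: \<kappa>_def add.commute)
          then have "sqrt ((?x i)\<^sup>2) \<le> K * sqrt (\<kappa> ^ ?d)"
            unfolding K_def real_sqrt_mult[symmetric] by (rule real_sqrt_le_mono)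
          then show ?thesis
            by (simp add: sqrt_pow)
        qed
        \<comment> \<open>Both marginals vanish outside the color range, so their difference is a
          vector on which \<open>N\<close> is a norm.\<close>
        moreover have "color_marginal \<mu> v i = 0" if "i \<notin> {1..q}" "\<mu> = \<nu> \<or> \<mu> = \<nu>'" for \<mu> i
        proof -
          have "space \<mu> = colorings V E q"
            using that(2) \<nu> gibbs
            by (auto simp: conditioned_measure_def gibbs_measure_def coloring_measure_def split: if_splits)
          then have "{\<omega>\<in>space \<mu>. \<omega> v = i} = {}"
            using that(1) U(2) by (auto simp: colorings_def)
          then show ?thesis
            by (simp only: color_marginal_def measure_empty)
        qed
        then have "?x \<in> real_vectors q"
          by (auto simp: real_vectors_def)
        ultimately have "N ?x \<le> (\<Sum>i\<in>{1..q}. K * exp (- a * real ?d) * N (\<lambda>j. of_bool (j = i)))"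
          using Ne by (intro order_trans[OF vector_norm_le[OF N]] sum_mono mult_right_mono) auto
        also have "\<dots> = K * L * exp (- a * real ?d)"
          by (simp add: L_def sum_distrib_left sum_distrib_right mult_ac)
        also have "\<dots> \<le> (K * L + 1) * exp (- a * real ?d)"
          by (intro mult_right_mono) auto
        finally show "N ?x \<le> (K * L + 1) * exp (- a * real ?d)" .
      qed
    qed
  qed
qed

end
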